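(* Let $(M,g)$ be an $n$-dimensional $(N(k),\xi)$-semi-Riemannian manifold, let $a_0,\dots,a_7,b_0,\dots,b_7$ be real numbers, let $\ell\ge0$ be an integer, and suppose $M$ is $(\mathcal{T}_a,S_{\mathcal{T}_b},S^\ell)$-pseudosymmetric, i.e. $\mathcal{T}_a\cdot S_{\mathcal{T}_b}=L\,Q(S^\ell,S_{\mathcal{T}_b})$ for a smooth function $L$ on $M$. Then for all vector fields $Y,U$: \begin{align*} &\varepsilon a_5(b_0+nb_1+b_2+b_3+b_5+b_6)S^2(Y,U)\\ &+\big\{\varepsilon(b_0+nb_1+b_2+b_3+b_5+b_6)(-ka_0+k(n-1)a_1+k(n-1)a_2-a_7r)\\ &\qquad+\varepsilon(a_1+a_5)(b_4r+(n-1)b_7r)\big\}S(Y,U)\\ &+\big\{\varepsilon k(n-1)(a_2+a_4)(b_4r+(n-1)b_7r)\\ &\qquad+\varepsilon k(n-1)(b_0+nb_1+b_2+b_3+b_5+b_6)(ka_0+k(n-1)a_4+a_7r)\big\}g(Y,U)\\ &+k(n-1)(a_1+a_2+2a_3+a_4+a_5+2a_6)\big\{b_4r+(n-1)b_7r\\ &\qquad+k(n-1)(b_0+nb_1+b_2+b_3+b_5+b_6)\big\}\eta(Y)\eta(U)\\ =\;&L\varepsilon\Big((b_0+nb_1+b_2+b_3+b_5+b_6)\big(k(n-1)S^\ell(Y,U)-k^\ell(n-1)^\ell S(Y,U)\big)\\ &\qquad+(b_4+(n-1)b_7)r\big(k^\ell(n-1)^\ell g(Y,U)-S^\ell(Y,U)\big)\Big).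 \end{align*} In particular, if $M$ is $(\mathcal{T}_a,S_{\mathcal{T}_a},S^\ell)$-pseudosymmetric, i.e. $\mathcal{T}_a\cdot S_{\mathcal{T}_a}=L\,Q(S^\ell,S_{\mathcal{T}_a})$ for a smooth function $L$ on $M$, then \begin{align*} &\varepsilon a_5(a_0+na_1+a_2+a_3+a_5+a_6)S^2(Y,U)\\ &+\big\{\varepsilon(a_0+na_1+a_2+a_3+a_5+a_6)(-ka_0+k(n-1)a_1+k(n-1)a_2-a_7r)\\ &\qquad+\varepsilon(a_1+a_5)(a_4r+(n-1)a_7r)\big\}S(Y,U)\\ &+\big\{\varepsilon k(n-1)(a_2+a_4)(a_4r+(n-1)a_7r)\\ &\qquad+\varepsilon k(n-1)(a_0+na_1+a_2+a_3+a_5+a_6)(ka_0+k(n-1)a_4+a_7r)\big\}g(Y,U)\\ &+k(n-1)(a_1+a_2+2a_3+a_4+a_5+2a_6)\big\{a_4r+(n-1)a_7r\\ &\qquad+k(n-1)(a_0+na_1+a_2+a_3+a_5+a_6)\big\}\eta(Y)\eta(U)\\ =\;&L\varepsilon\Big((a_0+na_1+a_2+a_3+a_5+a_6)\big(k(n-1)S^\ell(Y,U)-k^\ell(n-1)^\ell S(Y,U)\big)\\ &\qquad+(a_4+(n-1)a_7)r\big(k^\ell(n-1)^\ell g(Y,U)-S^\ell(Y,U)\big)\Big). \end{align*}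
   Context: $(M,g)$ is an $n$-dimensional semi-Riemannian manifold; $R$ is its curvature tensor (sign convention: constant curvature $c$ means $R(X,Y)Z=c(g(Y,Z)X-g(X,Z)Y)$), $S(Y,Z)=\mathrm{tr}(X\mapsto R(X,Y)Z)$ the Ricci tensor, $Q$ the Ricci operator ($g(QX,Y)=S(X,Y)$), $r$ the scalar curvature. $S^\ell(X,Y)=g(Q^\ell X,Y)$ for $\ell=0,1,2,\dots$, so $S^0=g$, $S^1=S$; $k^0(n-1)^0=1$. $(N(k),\xi)$-semi-Riemannian manifold: $k$ is a real number and $\xi$ is a non-null unit vector field, $g(\xi,\xi)=\varepsilon\in\{1,-1\}$, lying in the $k$-nullity distribution, i.e. $R(X,Y)\xi=k(g(Y,\xi)X-g(X,\xi)Y)$ for all $X,Y$; $\eta(X)=\varepsilon g(X,\xi)$. For real $a_0,\dots,a_7$, the $\mathcal{T}_a$-curvature tensor is $\mathcal{T}_a(X,Y)Z=a_0R(X,Y)Z+a_1S(Y,Z)X+a_2S(X,Z)Y+a_3S(X,Y)Z+a_4g(Y,Z)QX+a_5g(X,Z)QY+a_6g(X,Y)QZ+a_7r(g(Y,Z)X-g(X,Z)Y)$; $\mathcal{T}_b$ is the same with $b_i$ in place of $a_i$. $S_{\mathcal{T}_a}(Y,Z)=\mathrm{tr}(X\mapsto\mathcal{T}_a(X,Y)Z)$, i.e. $S_{\mathcal{T}_a}=(a_0+na_1+a_2+a_3+a_5+a_6)S+(a_4+(n-1)a_7)r\,g$; likewise $S_{\mathcal{T}_b}$. For a $(0,2)$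 tensor $K$ and endomorphism $F$, $(F\cdot K)(U,V)=-K(FU,V)-K(U,FV)$. $(\mathcal{T}_a\cdot K)(U,V;X,Y)=(\mathcal{T}_a(X,Y)\cdot K)(U,V)$, and, for a $(0,2)$ tensor $\sigma$, $Q(\sigma,K)(U,V;X,Y)=((X\wedge_\sigma Y)\cdot K)(U,V)$ with $(X\wedge_\sigma Y)Z=\sigma(Y,Z)X-\sigma(X,Z)Y$.
   Formalization: In both displays the last factor on the right is taken as S^ℓ(Y,U) − k^ℓ(n−1)^ℓ g(Y,U), the negative of the printed one; the printed sign fails on ℝ×S² with k=0, ℓ=1, L=1, a_1=1, a_2=−1, b_4=1 and other coefficients 0. *)

theory Defs
  imports "HOL-Analysis.Analysis"
begin

section \<open>Smooth manifolds modelled on \<open>real ^ 'n\<close>\<close>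

text \<open>
  The points of the manifold are the elements of a Hausdorff, second countable type
  \<open>'a\<close>; the dimension is \<open>CARD('n)\<close>.
  The iterated derivatives below are only used on open sets of finite-dimensional spaces,
  where differentiability together with continuity of all directional derivatives is
  ordinary \<open>C\<^sup>k\<close>.
\<close>

primrec Ck_on :: "nat \<Rightarrow> 'b::real_normed_vector set \<Rightarrow> ('b \<Rightarrow> 'c::real_normed_vector) \<Rightarrow> bool" where
  "Ck_on 0 S f \<longleftrightarrow> continuous_on S f"
| "Ck_on (Suc k) S f \<longleftrightarrow>
     (\<forall>x\<in>S. f differentiable (at x)) \<and> (\<forall>v. Ck_on k S (\<lambda>x. frechet_derivative f (at x) v))"

definition smooth_on :: "'b::real_normed_vector set \<Rightarrow> ('b \<Rightarrow> 'c::real_normed_vector) \<Rightarrow> bool" where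
  "smooth_on S f \<longleftrightarrow> (\<forall>k. Ck_on k S f)"

text \<open>A chart is a pair of its domain and its coordinate map.\<close>

type_synonym ('a, 'n) chart = "'a set \<times> ('a \<Rightarrow> real ^ 'n)"

definition chart_inv :: "('a, 'n) chart \<Rightarrow> real ^ 'n \<Rightarrow> 'a" where
  "chart_inv c = inv_into (fst c) (snd c)"

definition smooth_atlas ::
  "('a::{t2_space, second_countable_topology}, 'n::finite) chart set \<Rightarrow> bool" where
  "smooth_atlas A \<longleftrightarrow>
     (\<forall>c\<in>A. open (fst c) \<and> open (snd c ` fst c) \<and>
        homeomorphism (fst c) (snd c ` fst c) (snd c) (chart_inv c)) \<and>
     (\<Union>c\<in>A. fst c) = UNIV \<and>
     (\<forall>c\<in>A. \<forall>d\<in>A. smooth_on (snd c ` (fst c \<inter> fst d)) (snd d \<circ> chart_inv c))"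

definition smooth_fun_on ::
  "('a, 'n::finite) chart set \<Rightarrow> 'a set \<Rightarrow> ('a \<Rightarrow> real) \<Rightarrow> bool" where
  "smooth_fun_on A W f \<longleftrightarrow> (\<forall>c\<in>A. smooth_on (snd c ` (fst c \<inter> W)) (f \<circ> chart_inv c))"

text \<open>
  Tangent vectors: the tangent space at \<open>p\<close> is \<open>real ^ 'n\<close>, a vector being given by its
  components in the chart \<open>chart_at A p\<close>, which is chosen once and for all for each point.
  The maps \<open>to_chart A c p\<close> and \<open>of_chart A c p\<close>, the derivatives of the coordinate changes,
  convert to and from the components in another chart \<open>c\<close> around \<open>p\<close>.  A vector field is a
  function \<open>X\<close> with \<open>X p\<close> tangent at \<open>p\<close>; as \<open>chart_at A p\<close> may jump with \<open>p\<close>, its smoothness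
  is that of its components \<open>field_rep A c X\<close> in each fixed chart \<open>c\<close>.
\<close>

definition chart_at :: "('a, 'n) chart set \<Rightarrow> 'a \<Rightarrow> ('a, 'n) chart" where
  "chart_at A p = (SOME c. c \<in> A \<and> p \<in> fst c)"

definition to_chart ::
  "('a, 'n::finite) chart set \<Rightarrow> ('a, 'n) chart \<Rightarrow> 'a \<Rightarrow> real ^ 'n \<Rightarrow> real ^ 'n" where
  "to_chart A c p =
     frechet_derivative (snd c \<circ> chart_inv (chart_at A p)) (at (snd (chart_at A p) p))"

definition of_chart ::
  "('a, 'n::finite) chart set \<Rightarrow> ('a, 'n) chart \<Rightarrow> 'a \<Rightarrow> real ^ 'n \<Rightarrow> real ^ 'n" where
  "of_chart A c p = frechet_derivative (snd (chart_at A p) \<circ> chart_inv c) (at (snd c p))"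

definition field_rep ::
  "('a, 'n::finite) chart set \<Rightarrow> ('a, 'n) chart \<Rightarrow> ('a \<Rightarrow> real ^ 'n) \<Rightarrow> real ^ 'n \<Rightarrow> real ^ 'n" where
  "field_rep A c X x = to_chart A c (chart_inv c x) (X (chart_inv c x))"

definition smooth_field_on ::
  "('a, 'n::finite) chart set \<Rightarrow> 'a set \<Rightarrow> ('a \<Rightarrow> real ^ 'n) \<Rightarrow> bool" where
  "smooth_field_on A W X \<longleftrightarrow> (\<forall>c\<in>A. smooth_on (snd c ` (fst c \<inter> W)) (field_rep A c X))"

definition dir_deriv ::
  "('a, 'n::finite) chart set \<Rightarrow> ('a \<Rightarrow> real) \<Rightarrow> 'a \<Rightarrow> real ^ 'n \<Rightarrow> real" where
  "dir_deriv A f p u =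
     frechet_derivative (f \<circ> chart_inv (chart_at A p)) (at (snd (chart_at A p) p)) u"

definition lie_bracket ::
  "('a, 'n::finite) chart set \<Rightarrow> ('a \<Rightarrow> real ^ 'n) \<Rightarrow> ('a \<Rightarrow> real ^ 'n) \<Rightarrow> 'a \<Rightarrow> real ^ 'n" where
  "lie_bracket A X Y p =
     (let c = chart_at A p; x = snd c p in
        frechet_derivative (field_rep A c Y) (at x) (X p)
      - frechet_derivative (field_rep A c X) (at x) (Y p))"


section \<open>Semi-Riemannian metrics, the Levi-Civita connection and curvature\<close>

definition form_index :: "(real ^ 'n \<Rightarrow> real ^ 'n \<Rightarrow> real) \<Rightarrow> nat" where
  "form_index B = Max {dim V | V. subspace V \<and> (\<forall>v\<in>V. v \<noteq> 0 \<longrightarrow> B v v < 0)}"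

definition semi_riemannian_manifold ::
  "('a::{t2_space, second_countable_topology}, 'n::finite) chart set \<Rightarrow>
   ('a \<Rightarrow> real ^ 'n \<Rightarrow> real ^ 'n \<Rightarrow> real) \<Rightarrow> bool" where
  "semi_riemannian_manifold A g \<longleftrightarrow>
     smooth_atlas A \<and>
     (\<forall>p. bilinear (g p) \<and> (\<forall>u v. g p u v = g p v u) \<and>
        (\<forall>u. (\<forall>v. g p u v = 0) \<longrightarrow> u = 0)) \<and>
     (\<exists>i. \<forall>p. form_index (g p) = i) \<and>
     (\<forall>c\<in>A. \<forall>u v. smooth_on (snd c ` fst c)
        (\<lambda>x. g (chart_inv c x) (of_chart A c (chart_inv c x) u) (of_chart A c (chart_inv c x) v)))"

text \<open>
  \<open>D Y p u\<close> is the covariant derivative at \<open>p\<close> of the vector field \<open>Y\<close> in the direction \<open>u\<close>, i.e.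
  \<open>(\<nabla>\<^sub>X Y)(p) = D Y p (X p)\<close>.  The axioms are imposed for fields that are smooth on an open set,
  so that \<open>D Y p\<close> is determined as soon as \<open>Y\<close> is smooth near \<open>p\<close> (and is arbitrary otherwise);
  this local form is equivalent to the one for globally defined smooth fields, because a
  connection is a local operator.
\<close>

definition affine_connection ::
  "('a::topological_space, 'n::finite) chart set \<Rightarrow>
   (('a \<Rightarrow> real ^ 'n) \<Rightarrow> 'a \<Rightarrow> real ^ 'n \<Rightarrow> real ^ 'n) \<Rightarrow> bool" where
  "affine_connection A D \<longleftrightarrow>
     (\<forall>W Y. open W \<and> smooth_field_on A W Y \<longrightarrow>
        (\<forall>p\<in>W. linear (D Y p)) \<and>
        (\<forall>X. smooth_field_on A W X \<longrightarrow> smooth_field_on A W (\<lambda>p. D Y p (X p))) \<and>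
        (\<forall>Z. (\<forall>p\<in>W. Z p = Y p) \<longrightarrow> (\<forall>p\<in>W. D Z p = D Y p)) \<and>
        (\<forall>Z. smooth_field_on A W Z \<longrightarrow>
           (\<forall>p\<in>W. \<forall>u. D (\<lambda>q. Y q + Z q) p u = D Y p u + D Z p u)) \<and>
        (\<forall>f. smooth_fun_on A W f \<longrightarrow>
           (\<forall>p\<in>W. \<forall>u. D (\<lambda>q. f q *\<^sub>R Y q) p u = dir_deriv A f p u *\<^sub>R Y p + f p *\<^sub>R D Y p u)))"

definition levi_civita ::
  "('a::topological_space, 'n::finite) chart set \<Rightarrow>
   ('a \<Rightarrow> real ^ 'n \<Rightarrow> real ^ 'n \<Rightarrow> real) \<Rightarrow>
   (('a \<Rightarrow> real ^ 'n) \<Rightarrow> 'a \<Rightarrow> real ^ 'n \<Rightarrow> real ^ 'n) \<Rightarrow> bool" where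
  "levi_civita A g D \<longleftrightarrow>
     affine_connection A D \<and>
     (\<forall>W X Y. open W \<and> smooth_field_on A W X \<and> smooth_field_on A W Y \<longrightarrow>
        (\<forall>p\<in>W. D Y p (X p) - D X p (Y p) = lie_bracket A X Y p) \<and>
        (\<forall>p\<in>W. \<forall>u. dir_deriv A (\<lambda>q. g q (X q) (Y q)) p u = g p (D X p u) (Y p) + g p (X p) (D Y p u)))"

text \<open>
  \<open>R\<close> is the curvature tensor of \<open>D\<close>:
  \<open>R(X,Y)Z = \<nabla>\<^sub>X \<nabla>\<^sub>Y Z - \<nabla>\<^sub>Y \<nabla>\<^sub>X Z - \<nabla>\<^bsub>[X,Y]\<^esub> Z\<close>.
  Since any tangent vectors at \<open>p\<close> extend to smooth fields near \<open>p\<close>, this determines \<open>R\<close>.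
\<close>

definition curvature_tensor ::
  "('a::topological_space, 'n::finite) chart set \<Rightarrow>
   (('a \<Rightarrow> real ^ 'n) \<Rightarrow> 'a \<Rightarrow> real ^ 'n \<Rightarrow> real ^ 'n) \<Rightarrow>
   ('a \<Rightarrow> real ^ 'n \<Rightarrow> real ^ 'n \<Rightarrow> real ^ 'n \<Rightarrow> real ^ 'n) \<Rightarrow> bool" where
  "curvature_tensor A D R \<longleftrightarrow>
     (\<forall>W X Y Z. open W \<and> smooth_field_on A W X \<and> smooth_field_on A W Y \<and> smooth_field_on A W Z \<longrightarrow>
        (\<forall>p\<in>W. R p (X p) (Y p) (Z p) =
             D (\<lambda>q. D Z q (Y q)) p (X p)
           - D (\<lambda>q. D Z q (X q)) p (Y p)
           - D Z p (lie_bracket A X Y p)))"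


section \<open>Tensors at a point\<close>

text \<open>
  From here on, \<open>g\<close> and \<open>R\<close> are the metric and the curvature tensor at one point, on the
  tangent space \<open>real ^ 'n\<close>.
\<close>

definition ricci ::
  "(real ^ 'n \<Rightarrow> real ^ 'n \<Rightarrow> real ^ 'n \<Rightarrow> real ^ 'n) \<Rightarrow> real ^ 'n \<Rightarrow> real ^ 'n \<Rightarrow> real" where
  "ricci R y z = trace (matrix (\<lambda>x. R x y z))"

definition ricci_op ::
  "(real ^ 'n \<Rightarrow> real ^ 'n \<Rightarrow> real) \<Rightarrow>
   (real ^ 'n \<Rightarrow> real ^ 'n \<Rightarrow> real ^ 'n \<Rightarrow> real ^ 'n) \<Rightarrow> real ^ 'n \<Rightarrow> real ^ 'n" where
  "ricci_op g R x = (THE w. \<forall>y. g w y = ricci R x y)"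

definition scalar_curvature ::
  "(real ^ 'n \<Rightarrow> real ^ 'n \<Rightarrow> real) \<Rightarrow>
   (real ^ 'n \<Rightarrow> real ^ 'n \<Rightarrow> real ^ 'n \<Rightarrow> real ^ 'n) \<Rightarrow> real" where
  "scalar_curvature g R = trace (matrix (ricci_op g R))"

definition ricci_power ::
  "(real ^ 'n \<Rightarrow> real ^ 'n \<Rightarrow> real) \<Rightarrow>
   (real ^ 'n \<Rightarrow> real ^ 'n \<Rightarrow> real ^ 'n \<Rightarrow> real ^ 'n) \<Rightarrow> nat \<Rightarrow> real ^ 'n \<Rightarrow> real ^ 'n \<Rightarrow> real" where
  "ricci_power g R l x y = g ((ricci_op g R ^^ l) x) y"

text \<open>The coefficients \<open>a\<^sub>0, \<dots>, a\<^sub>7\<close> are the values \<open>a 0, \<dots>, a 7\<close>.\<close>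

definition T_curv ::
  "(nat \<Rightarrow> real) \<Rightarrow> (real ^ 'n \<Rightarrow> real ^ 'n \<Rightarrow> real) \<Rightarrow>
   (real ^ 'n \<Rightarrow> real ^ 'n \<Rightarrow> real ^ 'n \<Rightarrow> real ^ 'n) \<Rightarrow>
   real ^ 'n \<Rightarrow> real ^ 'n \<Rightarrow> real ^ 'n \<Rightarrow> real ^ 'n" where
  "T_curv a g R x y z =
     a 0 *\<^sub>R R x y z
   + (a 1 * ricci R y z) *\<^sub>R x + (a 2 * ricci R x z) *\<^sub>R y + (a 3 * ricci R x y) *\<^sub>R z
   + (a 4 * g y z) *\<^sub>R ricci_op g R x + (a 5 * g x z) *\<^sub>R ricci_op g R y
   + (a 6 * g x y) *\<^sub>R ricci_op g R z
   + (a 7 * scalar_curvature g R) *\<^sub>R (g y z *\<^sub>R x - g x z *\<^sub>R y)"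

definition endo_act ::
  "(real ^ 'n \<Rightarrow> real ^ 'n) \<Rightarrow> (real ^ 'n \<Rightarrow> real ^ 'n \<Rightarrow> real) \<Rightarrow> real ^ 'n \<Rightarrow> real ^ 'n \<Rightarrow> real" where
  "endo_act F K u v = - K (F u) v - K u (F v)"

definition wedge ::
  "(real ^ 'n \<Rightarrow> real ^ 'n \<Rightarrow> real) \<Rightarrow> real ^ 'n \<Rightarrow> real ^ 'n \<Rightarrow> real ^ 'n \<Rightarrow> real ^ 'n" where
  "wedge \<sigma> x y z = \<sigma> y z *\<^sub>R x - \<sigma> x z *\<^sub>R y"

text \<open>\<open>curv_act T K u v x y\<close> is \<open>(T \<cdot> K)(u, v; x, y)\<close>, and
  \<open>tachibana \<sigma> K u v x y\<close> is \<open>Q(\<sigma>, K)(u, v; x, y)\<close>.\<close>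

definition curv_act ::
  "(real ^ 'n \<Rightarrow> real ^ 'n \<Rightarrow> real ^ 'n \<Rightarrow> real ^ 'n) \<Rightarrow> (real ^ 'n \<Rightarrow> real ^ 'n \<Rightarrow> real) \<Rightarrow>
   real ^ 'n \<Rightarrow> real ^ 'n \<Rightarrow> real ^ 'n \<Rightarrow> real ^ 'n \<Rightarrow> real" where
  "curv_act T K u v x y = endo_act (T x y) K u v"

definition tachibana ::
  "(real ^ 'n \<Rightarrow> real ^ 'n \<Rightarrow> real) \<Rightarrow> (real ^ 'n \<Rightarrow> real ^ 'n \<Rightarrow> real) \<Rightarrow>
   real ^ 'n \<Rightarrow> real ^ 'n \<Rightarrow> real ^ 'n \<Rightarrow> real ^ 'n \<Rightarrow> real" where
  "tachibana \<sigma> K u v x y = endo_act (wedge \<sigma> x y) K u v"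

definition nullity ::
  "real \<Rightarrow> (real ^ 'n \<Rightarrow> real ^ 'n \<Rightarrow> real) \<Rightarrow>
   (real ^ 'n \<Rightarrow> real ^ 'n \<Rightarrow> real ^ 'n \<Rightarrow> real ^ 'n) \<Rightarrow> (real ^ 'n) set" where
  "nullity k g R = {z. \<forall>x y. R x y z = k *\<^sub>R (g y z *\<^sub>R x - g x z *\<^sub>R y)}"


section \<open>Geometric structures on the manifold\<close>

definition N_k_xi_manifold ::
  "('a::{t2_space, second_countable_topology}, 'n::finite) chart set \<Rightarrow>
   ('a \<Rightarrow> real ^ 'n \<Rightarrow> real ^ 'n \<Rightarrow> real) \<Rightarrow>
   (('a \<Rightarrow> real ^ 'n) \<Rightarrow> 'a \<Rightarrow> real ^ 'n \<Rightarrow> real ^ 'n) \<Rightarrow>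
   ('a \<Rightarrow> real ^ 'n \<Rightarrow> real ^ 'n \<Rightarrow> real ^ 'n \<Rightarrow> real ^ 'n) \<Rightarrow>
   real \<Rightarrow> real \<Rightarrow> ('a \<Rightarrow> real ^ 'n) \<Rightarrow> bool" where
  "N_k_xi_manifold A g D R k \<epsilon> \<xi> \<longleftrightarrow>
     semi_riemannian_manifold A g \<and> levi_civita A g D \<and> curvature_tensor A D R \<and>
     smooth_field_on A UNIV \<xi> \<and> \<epsilon> \<in> {1, - 1} \<and>
     (\<forall>p. g p (\<xi> p) (\<xi> p) = \<epsilon> \<and> \<xi> p \<in> nullity k (g p) (R p))"

text \<open>
  Sign of the \<open>L\<close>-term in the theorem.  Evaluating the equation below at \<open>v = x = \<xi>\<close> gives, after a
  change of sign, \<open>L \<epsilon> (B (\<kappa> S\<^sup>l - \<kappa>\<^sup>l S) + C (S\<^sup>l - \<kappa>\<^sup>l g))\<close> with \<open>\<kappa> = k (n - 1)\<close> and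
  \<open>S\<^sub>b = B S + C g\<close>.  The printed formula has \<open>\<kappa>\<^sup>l g - S\<^sup>l\<close> in the second summand, which is a
  misprint: take \<open>\<real> \<times> S\<^sup>2\<close> with \<open>\<xi> = \<partial>\<^sub>t\<close>, \<open>k = 0\<close>, \<open>l = 1\<close>, \<open>L = 1\<close>, \<open>a\<^sub>1 = 1\<close>, \<open>a\<^sub>2 = -1\<close>, \<open>b\<^sub>4 = 1\<close>
  and all other coefficients 0.  Then \<open>T\<^sub>a(X,Y) = X \<and>\<^sub>S Y\<close>, so the equation below holds, but the
  printed identity would read \<open>r S = - r S\<close>.
\<close>

definition pseudosymmetric ::
  "('a::{t2_space, second_countable_topology}, 'n::finite) chart set \<Rightarrow>
   ('a \<Rightarrow> real ^ 'n \<Rightarrow> real ^ 'n \<Rightarrow> real) \<Rightarrow>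
   ('a \<Rightarrow> real ^ 'n \<Rightarrow> real ^ 'n \<Rightarrow> real ^ 'n \<Rightarrow> real ^ 'n) \<Rightarrow>
   (nat \<Rightarrow> real) \<Rightarrow> (nat \<Rightarrow> real) \<Rightarrow> nat \<Rightarrow> ('a \<Rightarrow> real) \<Rightarrow> bool" where
  "pseudosymmetric A g R a b l L \<longleftrightarrow>
     smooth_fun_on A UNIV L \<and>
     (\<forall>p u v x y.
        curv_act (T_curv a (g p) (R p)) (ricci (T_curv b (g p) (R p))) u v x y =
        L p * tachibana (ricci_power (g p) (R p) l) (ricci (T_curv b (g p) (R p))) u v x y)"

end

theory Submission
  imports Defs
begin

text \<open>
  Everything happens on one tangent space, by evaluating the pseudosymmetry equation
  \<open>T\<^sub>a \<cdot> S\<^sub>b = L Q(S\<^sup>l, S\<^sub>b)\<close> on \<open>(U, \<xi>; \<xi>, Y)\<close>, where \<open>S\<^sub>b\<close> is the Ricci contraction of \<open>T\<^sub>b\<close>.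
  Three facts make both sides computable:

    \<^item> \<open>S\<^sub>b = B S + C g\<close> with \<open>B = b\<^sub>0 + n b\<^sub>1 + b\<^sub>2 + b\<^sub>3 + b\<^sub>5 + b\<^sub>6\<close> and
      \<open>C = (b\<^sub>4 + (n - 1) b\<^sub>7) r\<close> (\<open>ricci_T_curv\<close>);
    \<^item> \<open>R(\<xi>, Y)U = k (g(Y, U) \<xi> - g(\<xi>, U) Y)\<close> (\<open>R_xi_left\<close>);
    \<^item> \<open>Q \<xi> = k (n - 1) \<xi>\<close>, hence \<open>S\<^sup>l(Y, \<xi>) = k\<^sup>l (n - 1)\<^sup>l g(Y, \<xi>)\<close> (\<open>ricci_xi\<close>, \<open>ricci_power_xi\<close>).

  Substitution and collection of terms then give the identity (\<open>pseudosymmetry_at_xi\<close>); the factor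
  \<open>\<epsilon>\<^sup>2 = 1\<close> turns \<open>g(Y, \<xi>) g(U, \<xi>)\<close> into \<open>\<eta>(Y) \<eta>(U)\<close>.  The second assertion is the case \<open>b = a\<close>.

  The first two facts rest on the symmetries of \<open>R\<close>: the contraction formula uses that \<open>S\<close> is
  symmetric, and the formula for \<open>R(\<xi>, Y)U\<close> uses \<open>g(R(X, Y)Z, W) = g(R(Z, W)X, Y)\<close>.
  These follow algebraically from the skew symmetries and the first Bianchi identity
  (\<open>pair_symmetry\<close>, \<open>ricci_commute\<close>).  The latter are derived from the Levi-Civita connection by
  means of the coordinate fields of a chart around the point, which are smooth and have vanishing
  brackets (\<open>smooth_coord_field\<close>, \<open>lie_bracket_coord_fields\<close>); in \<open>curvature_bianchi\<close> and
  \<open>curvature_orthogonal\<close> the curvature is a commutator of second covariant derivatives along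
  them.  This in turn needs that \<open>C\<^sup>k\<close> functions compose and that second derivatives are symmetric
  (\<open>Ck_on_compose\<close>, \<open>second_derivative_symmetric\<close>).
\<close>

section \<open>Calculus of \<open>C\<^sup>k\<close> functions\<close>

lemma differentiable_transform_open:
  assumes "f differentiable (at x)" and "open S" and "x \<in> S" and "\<And>y. y \<in> S \<Longrightarrow> f y = g y"
  shows "g differentiable (at x)"
  using has_derivative_transform_within_open[of f _ x UNIV S g] assms
  unfolding differentiable_def by blast

lemma Ck_on_cong:
  assumes "open S" and "\<And>x. x \<in> S \<Longrightarrow> f x = g x" and "Ck_on k S f"
  shows "Ck_on k S g"
  using assms(2,3)
proof (induction k arbitrary: f g)
  case 0
  then show ?case by (simp cong: continuous_on_cong)
next
  case (Suc k)
  have diff: "f differentiable (at x)" if "x \<in> S" for x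
    using Suc.prems(2) that by simp
  have eq: "frechet_derivative f (at x) = frechet_derivative g (at x)" if "x \<in> S" for x
    by (rule frechet_derivative_transform_within_open[OF diff[OF that] \<open>open S\<close> that])
       (rule Suc.prems(1))
  have "g differentiable (at x)" if "x \<in> S" for x
    by (rule differentiable_transform_open[OF diff[OF that] \<open>open S\<close> that Suc.prems(1)])
  moreover have "Ck_on k S (\<lambda>x. frechet_derivative g (at x) v)" for v
  proof (rule Suc.IH)
    show "Ck_on k S (\<lambda>x. frechet_derivative f (at x) v)"
      using Suc.prems(2) by simp
  qed (simp add: eq)
  ultimately show ?case by simp
qed

lemma Ck_on_SucD: "Ck_on (Suc k) S f \<Longrightarrow> Ck_on k S f"
proof (induction k arbitrary: f)
  case 0
  then show ?case
    by (auto intro!: continuous_at_imp_continuous_on differentiable_imp_continuous_within)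
next
  case (Suc k)
  have "Ck_on k S (\<lambda>x. frechet_derivative f (at x) v)" for v
    by (rule Suc.IH) (use Suc.prems in simp)
  then show ?case using Suc.prems by simp
qed

lemma Ck_on_const: "Ck_on k S (\<lambda>x. c)"
  by (induction k arbitrary: c) auto

text \<open>
  The closure properties below share one pattern: the derivative of the composite, given by the
  chain or product rule, is built from functions that are \<open>C\<^sup>k\<close> when the given ones are
  \<open>C\<^sup>k\<^sup>+\<^sup>1\<close>, so an induction on \<open>k\<close> that generalizes over the functions applies.
\<close>

lemma Ck_on_bounded_linear:
  assumes "bounded_linear h" and "open S" and "Ck_on k S f"
  shows "Ck_on k S (\<lambda>x. h (f x))"
  using assms(3)
proof (induction k arbitrary: f)
  case 0
  then show ?case
    by (simp add: bounded_linear.continuous_on[OF assms(1)])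
next
  case (Suc k)
  have der: "((\<lambda>x. h (f x)) has_derivative (\<lambda>v. h (frechet_derivative f (at x) v))) (at x)"
    if "x \<in> S" for x
    using Suc.prems that
    by (intro bounded_linear.has_derivative[OF assms(1)]) (simp add: frechet_derivative_works)
  have "Ck_on k S (\<lambda>x. frechet_derivative (\<lambda>x. h (f x)) (at x) v)" for v
  proof (rule Ck_on_cong[OF assms(2)])
    show "Ck_on k S (\<lambda>x. h (frechet_derivative f (at x) v))"
      by (rule Suc.IH) (use Suc.prems in simp)
  qed (simp add: frechet_derivative_at[OF der, symmetric])
  then show ?case using der by (auto intro: differentiableI)
qed

lemma Ck_on_add:
  assumes "open S" and "Ck_on k S f" and "Ck_on k S g"
  shows "Ck_on k S (\<lambda>x. f x + g x)"
  using assms(2,3)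
proof (induction k arbitrary: f g)
  case 0
  then show ?case by (simp add: continuous_on_add)
next
  case (Suc k)
  have der: "((\<lambda>x. f x + g x) has_derivative
      (\<lambda>v. frechet_derivative f (at x) v + frechet_derivative g (at x) v)) (at x)"
    if "x \<in> S" for x
    using Suc.prems that by (intro has_derivative_add) (simp_all add: frechet_derivative_works)
  have "Ck_on k S (\<lambda>x. frechet_derivative (\<lambda>x. f x + g x) (at x) v)" for v
  proof (rule Ck_on_cong[OF assms(1)])
    show "Ck_on k S (\<lambda>x. frechet_derivative f (at x) v + frechet_derivative g (at x) v)"
      by (rule Suc.IH) (use Suc.prems in simp_all)
  qed (simp add: frechet_derivative_at[OF der, symmetric])
  then show ?case using der by (auto intro: differentiableI)
qed

lemma Ck_on_sum:
  assumes "open S" and "\<And>i. i \<in> I \<Longrightarrow> Ck_on k S (f i)"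
  shows "Ck_on k S (\<lambda>x. \<Sum>i\<in>I. f i x)"
  using assms(2)
  by (induction I rule: infinite_finite_induct) (auto intro: Ck_on_const Ck_on_add[OF assms(1)])

lemma Ck_on_scaleR:
  fixes f :: "'b::real_normed_vector \<Rightarrow> real"
  assumes "open S" and "Ck_on k S f" and "Ck_on k S g"
  shows "Ck_on k S (\<lambda>x. f x *\<^sub>R g x)"
  using assms(2,3)
proof (induction k arbitrary: f g)
  case 0
  then show ?case by (simp add: continuous_on_scaleR)
next
  case (Suc k)
  have der: "((\<lambda>x. f x *\<^sub>R g x) has_derivative
      (\<lambda>v. f x *\<^sub>R frechet_derivative g (at x) v + frechet_derivative f (at x) v *\<^sub>R g x)) (at x)"
    if "x \<in> S" for x
    using Suc.prems that by (intro has_derivative_scaleR) (simp_all add: frechet_derivative_works)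
  have "Ck_on k S (\<lambda>x. frechet_derivative (\<lambda>x. f x *\<^sub>R g x) (at x) v)" for v
  proof (rule Ck_on_cong[OF assms(1)])
    show "Ck_on k S (\<lambda>x. f x *\<^sub>R frechet_derivative g (at x) v
        + frechet_derivative f (at x) v *\<^sub>R g x)"
      using Suc.prems
      by (intro Ck_on_add[OF assms(1)] Suc.IH Ck_on_SucD[OF Suc.prems(1)] Ck_on_SucD[OF Suc.prems(2)])
         simp_all
  qed (simp add: frechet_derivative_at[OF der, symmetric])
  then show ?case using der by (auto intro: differentiableI)
qed

text \<open>
  The derivatives of \<open>f\<close> are controlled only in fixed directions, whereas the chain rule evaluates
  \<open>Df\<close> in the varying direction \<open>Dg(x)v\<close>.  Expanding that direction in a basis turns \<open>D(f \<circ> g)v\<close>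
  into a finite sum of products to which the induction hypothesis applies.
\<close>

lemma Ck_on_compose:
  fixes g :: "'b::real_normed_vector \<Rightarrow> 'c::euclidean_space"
    and f :: "'c \<Rightarrow> 'd::real_normed_vector"
  assumes "open S" and "open T" and "g ` S \<subseteq> T" and "Ck_on k T f" and "Ck_on k S g"
  shows "Ck_on k S (f \<circ> g)"
  using assms(4,5)
proof (induction k arbitrary: f)
  case 0
  then show ?case using assms(3) by (auto intro!: continuous_on_compose intro: continuous_on_subset simp del: o_apply)
next
  case (Suc k)
  have der: "((f \<circ> g) has_derivative
      (frechet_derivative f (at (g x)) \<circ> frechet_derivative g (at x))) (at x)"
    and expand: "frechet_derivative f (at (g x)) (frechet_derivative g (at x) v) =
      (\<Sum>i\<in>Basis. (frechet_derivative g (at x) v \<bullet> i) *\<^sub>R frechet_derivative f (at (g x)) i)"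
    if "x \<in> S" for x v
  proof -
    have diff: "f differentiable (at (g x))" "g differentiable (at x)"
      using Suc.prems that assms(3) by auto
    then show "((f \<circ> g) has_derivative
        (frechet_derivative f (at (g x)) \<circ> frechet_derivative g (at x))) (at x)"
      by (intro diff_chain_at) (simp_all add: frechet_derivative_works)
    have lin: "linear (frechet_derivative f (at (g x)))"
      by (rule linear_frechet_derivative[OF diff(1)])
    show "frechet_derivative f (at (g x)) (frechet_derivative g (at x) v) =
        (\<Sum>i\<in>Basis. (frechet_derivative g (at x) v \<bullet> i) *\<^sub>R frechet_derivative f (at (g x)) i)"
      by (subst (1) euclidean_representation[of "frechet_derivative g (at x) v", symmetric])
         (simp only: linear_sum[OF lin] linear_scale[OF lin])
  qed
  have "Ck_on k S (\<lambda>x. frechet_derivative (f \<circ> g) (at x) v)" for v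
  proof (rule Ck_on_cong[OF assms(1)])
    have "Ck_on k S ((\<lambda>y. frechet_derivative f (at y) i) \<circ> g)" for i
      by (rule Suc.IH) (use Suc.prems in \<open>simp_all add: Ck_on_SucD[OF Suc.prems(2)]\<close>)
    then have c1: "Ck_on k S (\<lambda>x. frechet_derivative f (at (g x)) i)" for i
      by (simp add: o_def)
    have c2: "Ck_on k S (\<lambda>x. frechet_derivative g (at x) v \<bullet> i)" for i
      by (rule Ck_on_bounded_linear[OF bounded_linear_inner_left assms(1)]) (use Suc.prems in simp)
    show "Ck_on k S (\<lambda>x. \<Sum>i\<in>Basis. (frechet_derivative g (at x) v \<bullet> i) *\<^sub>R
        frechet_derivative f (at (g x)) i)"
      by (rule Ck_on_sum[OF assms(1) Ck_on_scaleR[OF assms(1) c2 c1]])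
  qed (simp add: frechet_derivative_at[OF der, symmetric] expand)
  then show ?case
    unfolding Ck_on.simps using der by (blast intro: differentiableI)
qed

lemma smooth_on_cong:
  "open S \<Longrightarrow> (\<And>x. x \<in> S \<Longrightarrow> f x = g x) \<Longrightarrow> smooth_on S f \<Longrightarrow> smooth_on S g"
  unfolding smooth_on_def by (blast intro: Ck_on_cong)

lemma smooth_on_compose:
  fixes g :: "'b::real_normed_vector \<Rightarrow> 'c::euclidean_space"
  assumes "open S" and "open T" and "g ` S \<subseteq> T" and "smooth_on T f" and "smooth_on S g"
  shows "smooth_on S (f \<circ> g)"
  using assms unfolding smooth_on_def by (blast intro: Ck_on_compose)

lemma smooth_on_differentiable: "smooth_on S f \<Longrightarrow> x \<in> S \<Longrightarrow> f differentiable (at x)"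
  unfolding smooth_on_def by (metis Ck_on.simps(2))

lemma smooth_on_derivative: "smooth_on S f \<Longrightarrow> smooth_on S (\<lambda>x. frechet_derivative f (at x) v)"
  unfolding smooth_on_def by (metis Ck_on.simps(2))

text \<open>
  Two applications of the mean value theorem, along \<open>u\<close> and then along \<open>v\<close>.  The second difference
  on the left is symmetric in \<open>u\<close> and \<open>v\<close>, and this is what makes the second derivative symmetric.
\<close>

lemma second_difference_mean_value:
  fixes f :: "'b::real_normed_vector \<Rightarrow> real"
  assumes f: "\<And>z. z \<in> S \<Longrightarrow> f differentiable (at z)"
    and df: "\<And>z. z \<in> S \<Longrightarrow> (\<lambda>y. frechet_derivative f (at y) u) differentiable (at z)"
    and "s > 0"
    and in_S: "\<And>t t'. t \<in> {0..s} \<Longrightarrow> t' \<in> {0..s} \<Longrightarrow> x + t *\<^sub>R u + t' *\<^sub>R v \<in> S"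
  obtains t t' where "t \<in> {0..s}" and "t' \<in> {0..s}"
    and "f (x + s *\<^sub>R u + s *\<^sub>R v) - f (x + s *\<^sub>R u) - f (x + s *\<^sub>R v) + f x =
      s\<^sup>2 * frechet_derivative (\<lambda>y. frechet_derivative f (at y) u) (at (x + t *\<^sub>R u + t' *\<^sub>R v)) v"
proof -
  define h where "h t = f (x + t *\<^sub>R u + s *\<^sub>R v) - f (x + t *\<^sub>R u + 0 *\<^sub>R v)" for t
  define h' where "h' t = frechet_derivative f (at (x + t *\<^sub>R u + s *\<^sub>R v)) u
    - frechet_derivative f (at (x + t *\<^sub>R u + 0 *\<^sub>R v)) u" for t
  have line: "((\<lambda>\<tau>. F (a + \<tau> *\<^sub>R w + b)) has_field_derivative
      frechet_derivative F (at (a + t *\<^sub>R w + b)) w) (at t)"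
    if F: "F differentiable (at (a + t *\<^sub>R w + b))" for F :: "'b \<Rightarrow> real" and a b w t
  proof -
    let ?D = "frechet_derivative F (at (a + t *\<^sub>R w + b))"
    have "((\<lambda>\<tau>. a + \<tau> *\<^sub>R w + b) has_derivative (\<lambda>\<tau>. \<tau> *\<^sub>R w)) (at t)"
      by (auto intro!: derivative_eq_intros)
    from diff_chain_at[OF this] F
    have "((\<lambda>\<tau>. F (a + \<tau> *\<^sub>R w + b)) has_derivative (\<lambda>\<tau>. ?D (\<tau> *\<^sub>R w))) (at t)"
      by (simp add: frechet_derivative_works o_def)
    moreover have "(\<lambda>\<tau>. ?D (\<tau> *\<^sub>R w)) = (*) (?D w)"
      using linear_frechet_derivative[OF F] by (auto simp: linear_scale)
    ultimately show ?thesis by (simp add: has_field_derivative_def)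
  qed
  have h: "(h has_field_derivative h' t) (at t)" if "t \<in> {0..s}" for t
    unfolding h_def h'_def using that in_S in_S[of t 0] \<open>s > 0\<close> by (intro DERIV_diff line f) auto
  have "\<exists>t. 0 < t \<and> t < s \<and> h s - h 0 = (s - 0) * h' t"
    by (rule MVT2) (use \<open>s > 0\<close> h in auto)
  then obtain t where t: "0 < t" "t < s" "h s - h 0 = s * h' t" by auto
  let ?k = "\<lambda>\<tau>. frechet_derivative f (at (x + t *\<^sub>R u + \<tau> *\<^sub>R v + 0)) u"
  have k: "(?k has_field_derivative frechet_derivative (\<lambda>y. frechet_derivative f (at y) u)
      (at (x + t *\<^sub>R u + \<tau> *\<^sub>R v + 0)) v) (at \<tau>)" if "\<tau> \<in> {0..s}" for \<tau>
    by (rule line) (use that t in_S df in auto)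
  have "\<exists>t'. 0 < t' \<and> t' < s \<and> ?k s - ?k 0 = (s - 0) *
      frechet_derivative (\<lambda>y. frechet_derivative f (at y) u) (at (x + t *\<^sub>R u + t' *\<^sub>R v + 0)) v"
    by (rule MVT2) (use \<open>s > 0\<close> k in auto)
  then obtain t' where t': "0 < t'" "t' < s" "h' t = s *
      frechet_derivative (\<lambda>y. frechet_derivative f (at y) u) (at (x + t *\<^sub>R u + t' *\<^sub>R v)) v"
    by (auto simp: h'_def)
  show ?thesis
    by (rule that[of t t']) (use t t' in \<open>simp_all add: h_def power2_eq_square algebra_simps\<close>)
qed

text \<open>
  Schwarz's theorem.  On a small parallelogram at \<open>x\<close> the second difference, divided by \<open>s\<^sup>2\<close>,
  is a value of \<open>D\<^sub>v D\<^sub>u f\<close> and also a value of \<open>D\<^sub>u D\<^sub>v f\<close>, at two points near \<open>x\<close>; by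
  continuity both are close to the values at \<open>x\<close>.
\<close>

lemma second_derivative_symmetric_real:
  fixes f :: "'b::real_normed_vector \<Rightarrow> real"
  assumes "open S" and "smooth_on S f" and "x \<in> S"
  shows "frechet_derivative (\<lambda>y. frechet_derivative f (at y) u) (at x) v =
         frechet_derivative (\<lambda>y. frechet_derivative f (at y) v) (at x) u"
proof -
  define F where "F u v z = frechet_derivative (\<lambda>y. frechet_derivative f (at y) u) (at z) v" for u v z
  have diff: "f differentiable (at z)" "(\<lambda>y. frechet_derivative f (at y) w) differentiable (at z)"
    if "z \<in> S" for z w
    using that assms(2) smooth_on_derivative smooth_on_differentiable by blast+
  have cont: "isCont (F u v) x" for u v
  proof -
    have "smooth_on S (F u v)"
      unfolding F_def by (intro smooth_on_derivative assms(2))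
    then show ?thesis
      using assms(3) by (intro differentiable_imp_continuous_within smooth_on_differentiable)
  qed
  have "\<bar>F u v x - F v u x\<bar> < e" if "e > 0" for e
  proof -
    obtain d where d: "d > 0" "ball x d \<subseteq> S"
        "\<And>z. dist z x < d \<Longrightarrow> \<bar>F u v z - F u v x\<bar> < e / 2"
        "\<And>z. dist z x < d \<Longrightarrow> \<bar>F v u z - F v u x\<bar> < e / 2"
    proof -
      obtain d1 where "d1 > 0" "ball x d1 \<subseteq> S" using assms openE by blast
      moreover obtain d2 where "d2 > 0" "\<And>z. dist z x < d2 \<Longrightarrow> \<bar>F u v z - F u v x\<bar> < e / 2"
        using cont[of u v] \<open>e > 0\<close> unfolding continuous_at_eps_delta dist_real_def
        by (meson half_gt_zero)
      moreover obtain d3 where "d3 > 0" "\<And>z. dist z x < d3 \<Longrightarrow> \<bar>F v u z - F v u x\<bar> < e / 2"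
        using cont[of v u] \<open>e > 0\<close> unfolding continuous_at_eps_delta dist_real_def
        by (meson half_gt_zero)
      ultimately show ?thesis
        by (intro that[of "min d1 (min d2 d3)"]) (auto simp: subset_iff)
    qed
      \<comment> \<open>This size keeps the closed parallelogram with sides \<open>s u\<close>, \<open>s v\<close> inside the ball of radius \<open>d\<close>.\<close>
  define s where "s = d / (norm u + norm v + 1)"
    have pos: "norm u + norm v + 1 > 0" by (smt (verit) norm_ge_zero)
    have s: "s > 0" using d(1) pos by (simp add: s_def)
    have near: "dist (x + t *\<^sub>R u + t' *\<^sub>R v) x < d" if "t \<in> {0..s}" "t' \<in> {0..s}" for t t'
    proof -
      have "dist (x + t *\<^sub>R u + t' *\<^sub>R v) x = norm (t *\<^sub>R u + t' *\<^sub>R v)"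
        by (simp add: dist_norm algebra_simps)
      also have "\<dots> \<le> s * norm u + s * norm v"
        using that by (intro norm_triangle_le add_mono) (auto intro!: mult_right_mono)
      also have "\<dots> < s * (norm u + norm v + 1)" using s by (simp add: algebra_simps)
      also have "\<dots> = d" using pos by (simp add: s_def)
      finally show ?thesis .
    qed
    have in_S: "x + t *\<^sub>R u + t' *\<^sub>R v \<in> S" if "t \<in> {0..s}" "t' \<in> {0..s}" for t t'
      using near[OF that] d(2) by (auto simp: dist_commute)
    obtain t t' where t: "t \<in> {0..s}" "t' \<in> {0..s}"
      "f (x + s *\<^sub>R u + s *\<^sub>R v) - f (x + s *\<^sub>R u) - f (x + s *\<^sub>R v) + f x =
        s\<^sup>2 * F u v (x + t *\<^sub>R u + t' *\<^sub>R v)"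
      unfolding F_def by (rule second_difference_mean_value[OF diff s in_S])
    have in_S': "x + t *\<^sub>R v + t' *\<^sub>R u \<in> S" if "t \<in> {0..s}" "t' \<in> {0..s}" for t t'
      using in_S[OF that(2,1)] by (simp add: algebra_simps)
    obtain q q' where q: "q \<in> {0..s}" "q' \<in> {0..s}"
      "f (x + s *\<^sub>R v + s *\<^sub>R u) - f (x + s *\<^sub>R v) - f (x + s *\<^sub>R u) + f x =
        s\<^sup>2 * F v u (x + q *\<^sub>R v + q' *\<^sub>R u)"
      unfolding F_def by (rule second_difference_mean_value[OF diff s in_S'])
    have "s\<^sup>2 * F u v (x + t *\<^sub>R u + t' *\<^sub>R v) = s\<^sup>2 * F v u (x + q' *\<^sub>R u + q *\<^sub>R v)"
      using t(3) q(3) by (simp add: algebra_simps)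
    then have "F u v (x + t *\<^sub>R u + t' *\<^sub>R v) = F v u (x + q' *\<^sub>R u + q *\<^sub>R v)"
      using s by simp
    then show ?thesis
      using d(3)[OF near[OF t(1,2)]] d(4)[OF near[OF q(2,1)]] by linarith
  qed
  then have "F u v x = F v u x"
    by (metis abs_ge_zero less_irrefl not_less zero_less_abs_iff right_minus_eq)
  then show ?thesis by (simp add: F_def)
qed

lemma second_derivative_symmetric:
  fixes f :: "'b::real_normed_vector \<Rightarrow> 'c::euclidean_space"
  assumes "open S" and "smooth_on S f" and "x \<in> S"
  shows "frechet_derivative (\<lambda>y. frechet_derivative f (at y) u) (at x) v =
         frechet_derivative (\<lambda>y. frechet_derivative f (at y) v) (at x) u"
proof (rule euclidean_eqI)
  fix i :: 'c
  have comp: "frechet_derivative (\<lambda>y. F y \<bullet> i) (at z) w = frechet_derivative F (at z) w \<bullet> i"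
    if "F differentiable (at z)" for F :: "'b \<Rightarrow> 'c" and z w
    using frechet_derivative_at[OF bounded_linear.has_derivative[OF bounded_linear_inner_left
        that[unfolded frechet_derivative_works]], of i] by metis
  have "smooth_on S (\<lambda>y. f y \<bullet> i)"
    using assms(1,2) unfolding smooth_on_def
    by (blast intro: Ck_on_bounded_linear[OF bounded_linear_inner_left])
  note sym = second_derivative_symmetric_real[OF assms(1) this assms(3), of u v]
  have "frechet_derivative (\<lambda>y. frechet_derivative f (at y) u) (at x) v \<bullet> i =
      frechet_derivative (\<lambda>y. frechet_derivative (\<lambda>y. f y \<bullet> i) (at y) u) (at x) v" for u v
  proof -
    let ?G = "\<lambda>y. frechet_derivative f (at y) u"
    have dG: "?G differentiable (at x)"
      by (rule smooth_on_differentiable[OF smooth_on_derivative[OF assms(2)] assms(3)])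
    have eq: "frechet_derivative (\<lambda>y. ?G y \<bullet> i) (at x) =
        frechet_derivative (\<lambda>y. frechet_derivative (\<lambda>y. f y \<bullet> i) (at y) u) (at x)"
    proof (rule frechet_derivative_transform_within_open[OF _ assms(1,3)])
      show "(\<lambda>y. ?G y \<bullet> i) differentiable (at x)"
        using dG by (intro differentiable_inner) auto
    qed (simp add: comp smooth_on_differentiable[OF assms(2)])
    show ?thesis by (simp add: comp[OF dG, symmetric] eq)
  qed
  then show "frechet_derivative (\<lambda>y. frechet_derivative f (at y) u) (at x) v \<bullet> i =
      frechet_derivative (\<lambda>y. frechet_derivative f (at y) v) (at x) u \<bullet> i"
    using sym by simp
qed

section \<open>Coordinate fields\<close>

lemma homeomorphism_chart:
  "smooth_atlas A \<Longrightarrow> c \<in> A \<Longrightarrow> homeomorphism (fst c) (snd c ` fst c) (snd c) (chart_inv c)"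
  by (simp add: smooth_atlas_def)

lemma chart_inv_chart:
  "smooth_atlas A \<Longrightarrow> c \<in> A \<Longrightarrow> p \<in> fst c \<Longrightarrow> chart_inv c (snd c p) = p"
  using homeomorphism_chart[of A c] by (simp add: homeomorphism_def)

lemma open_chart_image:
  assumes "smooth_atlas A" and "c \<in> A" and "open W"
  shows "open (snd c ` (fst c \<inter> W))"
proof -
  have "openin (top_of_set (snd c ` fst c)) (snd c ` (fst c \<inter> W))"
    by (rule homeomorphism_imp_open_map[OF homeomorphism_chart[OF assms(1,2)]])
       (rule openin_open_Int[OF assms(3)])
  moreover have "open (snd c ` fst c)" using assms by (simp add: smooth_atlas_def)
  ultimately show ?thesis by (simp add: openin_open_eq)
qed

lemma open_chart_domain: "smooth_atlas A \<Longrightarrow> c \<in> A \<Longrightarrow> open (fst c)"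
  by (simp add: smooth_atlas_def)

lemma chart_at:
  assumes "smooth_atlas A"
  shows "chart_at A p \<in> A" and "p \<in> fst (chart_at A p)"
proof -
  have "p \<in> (\<Union>c\<in>A. fst c)" using assms by (simp add: smooth_atlas_def)
  then have "\<exists>c. c \<in> A \<and> p \<in> fst c" by blast
  from someI_ex[OF this] show "chart_at A p \<in> A" and "p \<in> fst (chart_at A p)"
    by (simp_all add: chart_at_def)
qed

lemma smooth_transition:
  "smooth_atlas A \<Longrightarrow> c \<in> A \<Longrightarrow> d \<in> A \<Longrightarrow>
    smooth_on (snd c ` (fst c \<inter> fst d)) (snd d \<circ> chart_inv c)"
  by (simp add: smooth_atlas_def)

lemma transition_differentiable:
  assumes "smooth_atlas A" and "c \<in> A" and "d \<in> A" and "m \<in> fst c" and "m \<in> fst d"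
  shows "(snd d \<circ> chart_inv c) differentiable (at (snd c m))"
  by (rule smooth_on_differentiable[OF smooth_transition[OF assms(1-3)]]) (use assms in blast)

text \<open>
  The derivative of a function in the direction of a tangent vector does not depend on the chart.
  Applied to coordinate maps \<open>h\<close> this is the cocycle rule for the coordinate changes, applied to
  scalar functions it computes directional derivatives, and applied to the components of a field
  it computes Lie brackets.
\<close>

lemma derivative_change_of_chart:
  assumes A: "smooth_atlas A" "c \<in> A" "d \<in> A" and m: "m \<in> fst c" "m \<in> fst d"
    and h: "(h \<circ> chart_inv c) differentiable (at (snd c m))"
  shows "frechet_derivative (h \<circ> chart_inv d) (at (snd d m))
           (frechet_derivative (snd d \<circ> chart_inv c) (at (snd c m)) v) =
         frechet_derivative (h \<circ> chart_inv c) (at (snd c m)) v"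
proof -
  note cancel = chart_inv_chart[OF A(1,2)] chart_inv_chart[OF A(1,3)]
  have "((h \<circ> chart_inv c) \<circ> (snd c \<circ> chart_inv d)) differentiable (at (snd d m))"
    using h transition_differentiable[OF A(1,3,2) m(2,1)] m A cancel
    by (intro differentiable_chain_at) auto
  then have "(h \<circ> chart_inv d) differentiable (at (snd d m))"
    by (rule differentiable_transform_open[of _ _ "snd d ` (fst d \<inter> fst c)"])
       (use m A cancel in \<open>auto intro!: open_chart_image[OF A(1,3) open_chart_domain[OF A(1,2)]]\<close>)
  then have comp: "(((h \<circ> chart_inv d) \<circ> (snd d \<circ> chart_inv c)) has_derivative
      (frechet_derivative (h \<circ> chart_inv d) (at (snd d m)) \<circ>
       frechet_derivative (snd d \<circ> chart_inv c) (at (snd c m)))) (at (snd c m))"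
    using transition_differentiable[OF A m] m A cancel
    by (intro diff_chain_at) (simp_all add: frechet_derivative_works)
  have "((h \<circ> chart_inv c) has_derivative
      (frechet_derivative (h \<circ> chart_inv d) (at (snd d m)) \<circ>
       frechet_derivative (snd d \<circ> chart_inv c) (at (snd c m)))) (at (snd c m))"
    by (rule has_derivative_transform_within_open[OF comp, of "snd c ` (fst c \<inter> fst d)"])
       (use m A cancel in \<open>auto intro!: open_chart_image[OF A(1,2) open_chart_domain[OF A(1,3)]]\<close>)
  from frechet_derivative_at[OF this] show ?thesis by (metis comp_apply)
qed

lemma to_chart_of_chart:
  assumes "smooth_atlas A" and "c \<in> A" and "d \<in> A" and "m \<in> fst c" and "m \<in> fst d"
  shows "to_chart A d m (of_chart A c m v) =
    frechet_derivative (snd d \<circ> chart_inv c) (at (snd c m)) v"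
  unfolding to_chart_def of_chart_def
  by (rule derivative_change_of_chart[OF assms(1,2) chart_at(1)[OF assms(1)] assms(4)
        chart_at(2)[OF assms(1)] transition_differentiable[OF assms]])

lemma linear_of_chart:
  assumes "smooth_atlas A" and "c \<in> A" and "m \<in> fst c"
  shows "linear (of_chart A c m)"
  unfolding of_chart_def
  by (rule linear_frechet_derivative[OF transition_differentiable[OF assms(1,2)
        chart_at(1)[OF assms(1)] assms(3) chart_at(2)[OF assms(1)]]])

text \<open>
  The vector field whose components in the chart \<open>c\<close> are constantly \<open>u\<close>.  It is meaningful only on
  the domain of \<open>c\<close>, which is why fields have to be considered on open sets.
\<close>

definition coord_field :: "('a, 'n::finite) chart set \<Rightarrow> ('a, 'n) chart \<Rightarrow> real ^ 'n \<Rightarrow> 'a \<Rightarrow> real ^ 'n"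
  where "coord_field A c u q = of_chart A c q u"

lemma coord_field_chart_at:
  assumes A: "smooth_atlas A"
  shows "coord_field A (chart_at A p) u p = u"
proof -
  let ?c = "chart_at A p"
  note c = chart_at[OF A, of p]
  have "((snd ?c \<circ> chart_inv ?c) has_derivative (\<lambda>x. x)) (at (snd ?c p))"
    by (rule has_derivative_transform_within_open[OF has_derivative_ident, of "snd ?c ` (fst ?c \<inter> UNIV)"])
       (use c open_chart_image[OF A c(1) open_UNIV] chart_inv_chart[OF A c(1)] in auto)
  from frechet_derivative_at[OF this] show ?thesis
    by (metis coord_field_def of_chart_def)
qed

lemma field_rep_coord_field:
  assumes A: "smooth_atlas A" "c \<in> A" "d \<in> A" and x: "x \<in> snd d ` (fst d \<inter> fst c)"
  shows "field_rep A d (coord_field A c u) x =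
    ((\<lambda>m. frechet_derivative (snd d \<circ> chart_inv c) (at (snd c m)) u) \<circ> chart_inv d) x"
  using x to_chart_of_chart[OF A]
  by (auto simp: field_rep_def coord_field_def chart_inv_chart[OF A(1,3)])

lemma smooth_coord_field:
  assumes A: "smooth_atlas A" "c \<in> A"
  shows "smooth_field_on A (fst c) (coord_field A c u)"
  unfolding smooth_field_on_def
proof
  fix d assume d: "d \<in> A"
  have op: "open (snd d ` (fst d \<inter> fst c))" "open (snd c ` (fst c \<inter> fst d))"
    using A d by (auto intro!: open_chart_image open_chart_domain)
  have "smooth_on (snd d ` (fst d \<inter> fst c))
      ((\<lambda>z. frechet_derivative (snd d \<circ> chart_inv c) (at z) u) \<circ> (snd c \<circ> chart_inv d))"
    using A d chart_inv_chart[OF A(1) d]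
    by (intro smooth_on_compose[OF op] smooth_on_derivative smooth_transition) (auto simp: image_iff)
  then show "smooth_on (snd d ` (fst d \<inter> fst c)) (field_rep A d (coord_field A c u))"
    by (rule smooth_on_cong[OF op(1), rotated])
       (simp add: field_rep_coord_field[OF A d])
qed

lemma dir_deriv_coord_field:
  assumes "smooth_atlas A" and "c \<in> A" and "q \<in> fst c"
    and "(f \<circ> chart_inv c) differentiable (at (snd c q))"
  shows "dir_deriv A f q (coord_field A c v q) =
    frechet_derivative (f \<circ> chart_inv c) (at (snd c q)) v"
  unfolding dir_deriv_def coord_field_def of_chart_def
  by (rule derivative_change_of_chart[OF assms(1,2) chart_at(1)[OF assms(1)] assms(3)
        chart_at(2)[OF assms(1)] assms(4)])

text \<open>
  The bracket at \<open>q\<close> is computed in the chart \<open>d\<close> that is attached to \<open>q\<close>, in general not in \<open>c\<close>.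
  In \<open>d\<close> the components of a coordinate field of \<open>c\<close> are a first derivative of the transition map
  \<open>\<phi>\<close>, so the bracket is a difference of mixed second derivatives of \<open>\<phi>\<close>.
\<close>

lemma lie_bracket_coord_fields:
  assumes A: "smooth_atlas A" "c \<in> A" and q: "q \<in> fst c"
  shows "lie_bracket A (coord_field A c u) (coord_field A c v) q = 0"
proof -
  define d where "d = chart_at A q"
  have d: "d \<in> A" "q \<in> fst d" unfolding d_def by (rule chart_at[OF A(1)])+
  \<comment> \<open>\<open>h v\<close> is the field of components in \<open>d\<close> of the coordinate field \<open>v\<close>, as a function on the manifold.\<close>
  define \<phi> where "\<phi> = snd d \<circ> chart_inv c"
  define h where "h v m = frechet_derivative \<phi> (at (snd c m)) v" for v m
  note cancel = chart_inv_chart[OF A(1)]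
  have op: "open (snd d ` (fst d \<inter> fst c))" "open (snd c ` (fst c \<inter> fst d))"
    using A d by (auto intro!: open_chart_image open_chart_domain)
  have in_op: "snd d q \<in> snd d ` (fst d \<inter> fst c)" "snd c q \<in> snd c ` (fst c \<inter> fst d)"
    using q d by auto
  have \<phi>: "smooth_on (snd c ` (fst c \<inter> fst d)) \<phi>"
    unfolding \<phi>_def by (rule smooth_transition[OF A d(1)])
  have D\<phi>: "(\<lambda>z. frechet_derivative \<phi> (at z) v) differentiable (at (snd c q))" for v
    by (rule smooth_on_differentiable[OF smooth_on_derivative[OF \<phi>] in_op(2)])
  have h: "(h v \<circ> chart_inv c) differentiable (at (snd c q))"
    and h': "frechet_derivative (h v \<circ> chart_inv c) (at (snd c q)) =
      frechet_derivative (\<lambda>z. frechet_derivative \<phi> (at z) v) (at (snd c q))" for v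
  proof -
    have eq: "(\<lambda>z. frechet_derivative \<phi> (at z) v) z = (h v \<circ> chart_inv c) z"
      if "z \<in> snd c ` (fst c \<inter> fst d)" for z
      using that cancel[OF A(2)] by (auto simp: h_def)
    show "frechet_derivative (h v \<circ> chart_inv c) (at (snd c q)) =
      frechet_derivative (\<lambda>z. frechet_derivative \<phi> (at z) v) (at (snd c q))"
      using frechet_derivative_transform_within_open[OF D\<phi> op(2) in_op(2) eq] by metis
    show "(h v \<circ> chart_inv c) differentiable (at (snd c q))"
      by (rule differentiable_transform_open[OF D\<phi> op(2) in_op(2) eq])
  qed
  have "frechet_derivative (field_rep A d (coord_field A c v)) (at (snd d q)) (coord_field A c u q)
      = frechet_derivative (\<lambda>z. frechet_derivative \<phi> (at z) v) (at (snd c q)) u" for u v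
  proof -
    have "field_rep A d (coord_field A c v) differentiable (at (snd d q))"
      using smooth_coord_field[OF A, of v] d(1) in_op(1) unfolding smooth_field_on_def
      by (blast intro: smooth_on_differentiable)
    then have "frechet_derivative (field_rep A d (coord_field A c v)) (at (snd d q)) =
        frechet_derivative (h v \<circ> chart_inv d) (at (snd d q))"
      by (rule frechet_derivative_transform_within_open[OF _ op(1) in_op(1)])
         (simp add: field_rep_coord_field[OF A d(1)] h_def \<phi>_def)
    then have "frechet_derivative (field_rep A d (coord_field A c v)) (at (snd d q)) (coord_field A c u q) =
        frechet_derivative (h v \<circ> chart_inv d) (at (snd d q))
          (frechet_derivative (snd d \<circ> chart_inv c) (at (snd c q)) u)"
      by (simp add: coord_field_def of_chart_def d_def)
    also have "\<dots> = frechet_derivative (h v \<circ> chart_inv c) (at (snd c q)) u"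
      by (rule derivative_change_of_chart[OF A d(1) q d(2) h])
    finally show ?thesis by (simp add: h')
  qed
  then show ?thesis
    using second_derivative_symmetric[OF op(2) \<phi> in_op(2), of u v]
    by (simp add: lie_bracket_def Let_def d_def)
qed

section \<open>Symmetries of the curvature tensor\<close>

text \<open>
  At a point \<open>p\<close> the curvature is evaluated on the coordinate fields of the chart attached to \<open>p\<close>.
  They commute, which removes the bracket terms from the definition of the curvature and from the
  torsion condition, and they take arbitrary prescribed values at \<open>p\<close>.
\<close>

locale levi_civita_curvature =
  fixes A :: "('a::{t2_space, second_countable_topology}, 'n::finite) chart set"
    and g :: "'a \<Rightarrow> real ^ 'n \<Rightarrow> real ^ 'n \<Rightarrow> real"
    and D :: "('a \<Rightarrow> real ^ 'n) \<Rightarrow> 'a \<Rightarrow> real ^ 'n \<Rightarrow> real ^ 'n"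
    and R :: "'a \<Rightarrow> real ^ 'n \<Rightarrow> real ^ 'n \<Rightarrow> real ^ 'n \<Rightarrow> real ^ 'n"
  assumes manifold: "semi_riemannian_manifold A g"
    and connection: "levi_civita A g D"
    and curvature: "curvature_tensor A D R"
begin

lemma atlas: "smooth_atlas A"
  using manifold by (simp add: semi_riemannian_manifold_def)

lemma metric:
  "bilinear (g p) \<and> (\<forall>u v. g p u v = g p v u) \<and> (\<forall>u. (\<forall>v. g p u v = 0) \<longrightarrow> u = 0)"
  using manifold unfolding semi_riemannian_manifold_def by (elim conjE) (erule spec)

lemmas bilinear_g = metric[THEN conjunct1]
  and g_commute = metric[THEN conjunct2, THEN conjunct1, rule_format]
  and g_nondegenerate = metric[THEN conjunct2, THEN conjunct2, rule_format]

lemma metric_smooth: "c \<in> A \<Longrightarrow> smooth_on (snd c ` fst c)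
    (\<lambda>x. g (chart_inv c x) (of_chart A c (chart_inv c x) u) (of_chart A c (chart_inv c x) v))"
  using manifold unfolding semi_riemannian_manifold_def by (elim conjE) (drule (1) bspec, blast)

lemma affine: "affine_connection A D"
  using connection by (simp add: levi_civita_def)

lemmas D_axioms = affine[unfolded affine_connection_def, rule_format, OF conjI]
lemmas D_linear = D_axioms[THEN conjunct1, rule_format]
  and D_smooth = D_axioms[THEN conjunct2, THEN conjunct1, rule_format]
  and D_local = D_axioms[THEN conjunct2, THEN conjunct2, THEN conjunct1, rule_format]
  and D_add = D_axioms[THEN conjunct2, THEN conjunct2, THEN conjunct2, THEN conjunct1, rule_format]

lemmas levi_civita_axioms =
  connection[unfolded levi_civita_def, THEN conjunct2, rule_format, OF conjI, OF _ conjI]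
lemmas torsion_free = levi_civita_axioms[THEN conjunct1, rule_format]
  and metric_compatible = levi_civita_axioms[THEN conjunct2, rule_format]

lemmas curvature_formula =
  curvature[unfolded curvature_tensor_def, rule_format, OF conjI, OF _ conjI, OF _ _ conjI]

definition chart_dom :: "'a \<Rightarrow> 'a set"
  where "chart_dom p = fst (chart_at A p)"

text \<open>
  \<open>E p u\<close> is the coordinate field with value \<open>u\<close> at \<open>p\<close>, and \<open>DE p v w\<close> is the field
  \<open>\<nabla>\<^bsub>E v\<^esub> (E w)\<close>.  As the fields commute, its symmetry in \<open>v\<close> and \<open>w\<close> is the vanishing
  of the torsion.
\<close>

definition E :: "'a \<Rightarrow> real ^ 'n \<Rightarrow> 'a \<Rightarrow> real ^ 'n"
  where "E p = coord_field A (chart_at A p)"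

definition DE :: "'a \<Rightarrow> real ^ 'n \<Rightarrow> real ^ 'n \<Rightarrow> 'a \<Rightarrow> real ^ 'n"
  where "DE p v w q = D (E p w) q (E p v q)"

lemma open_chart_dom: "open (chart_dom p)" and in_chart_dom: "p \<in> chart_dom p"
  using chart_at[OF atlas] open_chart_domain[OF atlas] by (auto simp: chart_dom_def)

lemma E_smooth: "smooth_field_on A (chart_dom p) (E p u)"
  unfolding E_def chart_dom_def by (rule smooth_coord_field[OF atlas chart_at(1)[OF atlas]])

lemma E_at: "E p u p = u"
  unfolding E_def by (rule coord_field_chart_at[OF atlas])

lemma E_add: "q \<in> chart_dom p \<Longrightarrow> E p (u + v) q = E p u q + E p v q"
  unfolding E_def chart_dom_def coord_field_def
  by (rule linear_add[OF linear_of_chart[OF atlas chart_at(1)[OF atlas]]])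

lemma E_commute: "q \<in> chart_dom p \<Longrightarrow> lie_bracket A (E p u) (E p v) q = 0"
  unfolding E_def chart_dom_def by (rule lie_bracket_coord_fields[OF atlas chart_at(1)[OF atlas]])

lemma DE_smooth: "smooth_field_on A (chart_dom p) (DE p v w)"
  unfolding DE_def[abs_def] by (rule D_smooth[OF open_chart_dom E_smooth E_smooth])

lemma DE_commute: "q \<in> chart_dom p \<Longrightarrow> DE p v w q = DE p w v q"
  using torsion_free[OF open_chart_dom E_smooth E_smooth, of q p v w] E_commute[of q p w v] E_commute[of q p v w]
  by (simp add: DE_def)

lemma D_DE_commute: "D (DE p v w) p u = D (DE p w v) p u"
  using D_local[OF open_chart_dom DE_smooth DE_commute in_chart_dom, of p w v] by simp

lemma DE_add: "q \<in> chart_dom p \<Longrightarrow> DE p v (w + w') q = DE p v w q + DE p v w' q"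
proof -
  assume q: "q \<in> chart_dom p"
  have "D (\<lambda>q. E p w q + E p w' q) q = D (E p (w + w')) q"
    by (rule D_local[OF open_chart_dom E_smooth _ q]) (simp add: E_add)
  then show ?thesis
    using D_add[OF open_chart_dom E_smooth E_smooth q, of w w'] by (simp add: DE_def)
qed

lemma D_DE_add: "D (DE p v (w + w')) p u = D (DE p v w) p u + D (DE p v w') p u"
proof -
  have "D (\<lambda>q. DE p v w q + DE p v w' q) p = D (DE p v (w + w')) p"
    by (rule D_local[OF open_chart_dom DE_smooth _ in_chart_dom]) (simp add: DE_add)
  then show ?thesis
    using D_add[OF open_chart_dom DE_smooth DE_smooth in_chart_dom, of p v w v w'] by simp
qed

lemma curvature_eq: "R p u v w = D (DE p v w) p u - D (DE p u w) p v"
proof -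
  have "R p (E p u p) (E p v p) (E p w p) = D (DE p v w) p (E p u p) - D (DE p u w) p (E p v p)
      - D (E p w) p (lie_bracket A (E p u) (E p v) p)"
    unfolding DE_def[abs_def]
    by (rule curvature_formula[OF open_chart_dom E_smooth E_smooth E_smooth in_chart_dom])
  then show ?thesis
    using linear_0[OF D_linear[OF open_chart_dom E_smooth in_chart_dom]]
    by (simp add: E_at E_commute[OF in_chart_dom])
qed

lemma curvature_skew: "R p u v w = - R p v u w"
  by (simp add: curvature_eq)

lemma curvature_add: "R p u v (w + w') = R p u v w + R p u v w'"
  by (simp add: curvature_eq D_DE_add)

text \<open>
  With commuting fields the six second covariant derivatives cancel in pairs, because
  \<open>\<nabla>\<^sub>v w = \<nabla>\<^sub>w v\<close>.
\<close>

lemma curvature_bianchi: "R p u v w + R p v w u + R p w u v = 0"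
  by (simp add: curvature_eq D_DE_commute[of p v w] D_DE_commute[of p u w] D_DE_commute[of p u v])

text \<open>
  Let \<open>F\<close> be \<open>g(w, w)\<close> in coordinates.  Metric compatibility, used twice, gives
  \<open>D\<^sub>u D\<^sub>v F = 2 g(\<nabla>\<^sub>u \<nabla>\<^sub>v w, w) + 2 g(\<nabla>\<^sub>v w, \<nabla>\<^sub>u w)\<close>.  The left side and the last term are
  symmetric in \<open>u\<close> and \<open>v\<close>, hence so is \<open>g(\<nabla>\<^sub>u \<nabla>\<^sub>v w, w)\<close>.
\<close>

lemma curvature_orthogonal: "g p (R p u v w) w = 0"
proof -
  define c where "c = chart_at A p"
  define f where "f q = g q (E p w q) (E p w q)" for q
  define F where "F = f \<circ> chart_inv c"
  have c: "c \<in> A" "p \<in> fst c" and dom_eq: "chart_dom p = fst c"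
    using chart_at[OF atlas] by (simp_all add: c_def chart_dom_def)
  note cancel = chart_inv_chart[OF atlas c(1)]
  have op: "open (snd c ` (fst c \<inter> UNIV))" by (rule open_chart_image[OF atlas c(1) open_UNIV])
  have in_op: "snd c q \<in> snd c ` (fst c \<inter> UNIV)" if "q \<in> fst c" for q using that by simp
  have F: "smooth_on (snd c ` (fst c \<inter> UNIV)) F"
    using metric_smooth[OF c(1), of w]
    by (simp add: F_def f_def E_def c_def coord_field_def o_def)
  have first: "2 * g q (DE p v w q) (E p w q) = frechet_derivative F (at (snd c q)) v"
    if "q \<in> fst c" for q v
  proof -
    have "dir_deriv A f q (E p v q) = frechet_derivative F (at (snd c q)) v"
      using dir_deriv_coord_field[OF atlas c(1) that] smooth_on_differentiable[OF F in_op[OF that]]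
      by (simp add: F_def E_def c_def)
    moreover have "dir_deriv A f q (E p v q) = g q (DE p v w q) (E p w q) + g q (E p w q) (DE p v w q)"
      unfolding f_def[abs_def] DE_def
      by (rule metric_compatible[OF open_chart_dom E_smooth E_smooth]) (simp add: dom_eq that)
    moreover have "g q (E p w q) (DE p v w q) = g q (DE p v w q) (E p w q)"
      by (rule g_commute)
    ultimately show ?thesis by simp
  qed
  have second: "2 * (g p (D (DE p v w) p u) w + g p (DE p v w p) (DE p u w p)) =
      frechet_derivative (\<lambda>z. frechet_derivative F (at z) v) (at (snd c p)) u" for u v
  proof -
    let ?h = "\<lambda>q. g q (DE p v w q) (E p w q)"
    have DF: "(\<lambda>z. frechet_derivative F (at z) v) differentiable (at (snd c p))"
      by (rule smooth_on_differentiable[OF smooth_on_derivative[OF F] in_op[OF c(2)]])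
    have "((\<lambda>z. frechet_derivative F (at z) v / 2) has_derivative
        (\<lambda>u. frechet_derivative (\<lambda>z. frechet_derivative F (at z) v) (at (snd c p)) u / 2)) (at (snd c p))"
      using DF by (auto intro!: derivative_eq_intros simp: frechet_derivative_works)
    then have "((?h \<circ> chart_inv c) has_derivative
        (\<lambda>u. frechet_derivative (\<lambda>z. frechet_derivative F (at z) v) (at (snd c p)) u / 2)) (at (snd c p))"
      by (rule has_derivative_transform_within_open[OF _ op in_op[OF c(2)]])
         (use first[of _ v, symmetric] cancel in auto)
    from fun_cong[OF frechet_derivative_at[OF this], of u]
    have "dir_deriv A ?h p u =
        frechet_derivative (\<lambda>z. frechet_derivative F (at z) v) (at (snd c p)) u / 2"
      unfolding dir_deriv_def c_def[symmetric] by (rule sym)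
    moreover have "dir_deriv A ?h p u = g p (D (DE p v w) p u) w + g p (DE p v w p) (DE p u w p)"
      using metric_compatible[OF open_chart_dom DE_smooth E_smooth in_chart_dom] by (simp add: E_at DE_def)
    ultimately show ?thesis by simp
  qed
  have "g p (D (DE p v w) p u) w = g p (D (DE p u w) p v) w"
    using second[of v u] second[of u v] second_derivative_symmetric[OF op F in_op[OF c(2)], of u v]
      g_commute[of p "DE p v w p" "DE p u w p"] by simp
  then show ?thesis
    by (simp add: curvature_eq bilinear_lsub[OF bilinear_g])
qed

end

section \<open>Algebra on one tangent space\<close>

lemma trace_matrix: "trace (matrix F) = (\<Sum>i\<in>UNIV. F (axis i 1) $ i)"
  by (simp add: trace_def matrix_def)

lemma vec_axis_expansion: "(\<Sum>i\<in>UNIV. (y $ i) *\<^sub>R axis i (1::real)) = y"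
  by (simp add: vec_eq_iff axis_def if_distrib cong: if_cong)

lemma linear_axis_expansion:
  fixes \<phi> :: "real ^ 'n \<Rightarrow> 'b::real_vector"
  assumes "linear \<phi>"
  shows "(\<Sum>i\<in>UNIV. (y $ i) *\<^sub>R \<phi> (axis i 1)) = \<phi> y"
  by (subst (2) vec_axis_expansion[of y, symmetric])
     (simp only: linear_sum[OF assms] linear_scale[OF assms])

text \<open>
  The form need not be definite, so a basis and its \<open>g\<close>-dual basis take the place of an
  orthonormal basis.
\<close>

locale scalar_product =
  fixes g :: "real ^ 'n::finite \<Rightarrow> real ^ 'n \<Rightarrow> real"
  assumes bilinear: "bilinear g"
    and commute: "g u v = g v u"
    and nondegenerate: "(\<And>v. g u v = 0) \<Longrightarrow> u = 0"
begin

lemmas linear_simps =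
  bilinear_ladd[OF bilinear] bilinear_radd[OF bilinear]
  bilinear_lsub[OF bilinear] bilinear_rsub[OF bilinear]
  bilinear_lneg[OF bilinear] bilinear_rneg[OF bilinear]
  bilinear_lmul[OF bilinear] bilinear_rmul[OF bilinear]

lemma linear_left: "linear (\<lambda>x. g x y)" and linear_right: "linear (g x)"
  using bilinear by (simp_all add: bilinear_def)

lemma eqI: "(\<And>z. g x z = g y z) \<Longrightarrow> x = y"
  using nondegenerate[of "x - y"] by (simp add: linear_simps)

lemma linearI_scalar_product:
  assumes "\<And>z. linear (\<lambda>x. g (F x) z)"
  shows "linear F"
proof (rule linearI)
  show "F (x + y) = F x + F y" for x y
    by (rule eqI) (use linear_add[OF assms] in \<open>simp add: linear_simps\<close>)
  show "F (c *\<^sub>R x) = c *\<^sub>R F x" for c x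
    by (rule eqI) (use linear_scale[OF assms] in \<open>simp add: linear_simps\<close>)
qed

text \<open>
  Lowering an index is injective by nondegeneracy, hence bijective for reasons of dimension.
\<close>

lemma functional_representable:
  assumes "linear \<phi>"
  obtains z where "\<And>w. g z w = \<phi> w"
proof -
  define B where "B z = (\<chi> i. g z (axis i 1))" for z
  have "linear B"
    by (rule linearI) (simp_all add: B_def vec_eq_iff linear_simps)
  moreover have "inj B"
  proof (rule linear_injective_0[OF \<open>linear B\<close>, THEN iffD2], intro allI impI)
    fix z assume "B z = 0"
    then have "g z (axis i 1) = 0" for i by (simp add: B_def vec_eq_iff)
    then have "g z v = 0" for v
      using linear_axis_expansion[OF linear_right[of z], of v] by simp
    then show "z = 0" by (rule nondegenerate)
  qed
  ultimately have "surj B" by (rule linear_inj_imp_surj)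
  then obtain z where "B z = (\<chi> i. \<phi> (axis i 1))" by (metis surjD)
  then have "g z (axis i 1) = \<phi> (axis i 1)" for i by (simp add: B_def vec_eq_iff)
  then have "g z w = \<phi> w" for w
    using linear_axis_expansion[OF linear_right[of z], of w] linear_axis_expansion[OF assms, of w]
    by simp
  then show ?thesis by (rule that)
qed

text \<open>
  The vectors \<open>f i\<close> below form the basis dual to the standard one.  Traces are sums of
  \<open>g(f\<^sub>i, F e\<^sub>i)\<close>, and the coefficients \<open>g(f\<^sub>i, f\<^sub>j)\<close> of the \<open>f\<^sub>i\<close> in the standard basis are
  symmetric, so the roles of the two bases can be exchanged.
\<close>

lemma trace_adjoint:
  assumes adj: "\<And>x y. g (F x) y = g x (G y)"
  shows "trace (matrix F) = trace (matrix G)"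
proof -
  have "\<exists>f. \<forall>w. g f w = w $ i" for i
    by (rule functional_representable[of "\<lambda>w. w $ i"]) (auto intro: linearI)
  then obtain f where f: "g (f i) w = w $ i" for i w by metis
  have f_symmetric: "f i $ j = f j $ i" for i j
    using f[of j "f i"] f[of i "f j"] commute[of "f i" "f j"] by simp
  have linear_G: "linear G"
  proof (rule linearI_scalar_product)
    fix z
    have "(\<lambda>x. g (G x) z) = g (F z)"
      by (rule ext) (simp only: adj commute[of "G _" z])
    then show "linear (\<lambda>x. g (G x) z)" by (simp add: linear_right)
  qed
  have "trace (matrix F) = (\<Sum>i\<in>UNIV. g (axis i 1) (G (f i)))"
    by (simp only: trace_matrix f[symmetric] commute[of "f _" "F _"] adj)
  also have "\<dots> = (\<Sum>i\<in>UNIV. \<Sum>j\<in>UNIV. f i $ j * g (axis i 1) (G (axis j 1)))"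
  proof (rule sum.cong[OF refl])
    fix i
    have "linear (\<lambda>x. g (axis i 1) (G x))"
      using linear_compose[OF linear_G linear_right] by (simp add: o_def)
    from linear_axis_expansion[OF this, of "f i"]
    show "g (axis i 1) (G (f i)) = (\<Sum>j\<in>UNIV. f i $ j * g (axis i 1) (G (axis j 1)))"
      by simp
  qed
  also have "\<dots> = (\<Sum>j\<in>UNIV. \<Sum>i\<in>UNIV. (f j $ i) *\<^sub>R g (axis i 1) (G (axis j 1)))"
    by (subst sum.swap) (simp add: f_symmetric)
  also have "\<dots> = (\<Sum>j\<in>UNIV. g (f j) (G (axis j 1)))"
    by (simp only: linear_axis_expansion[OF linear_left])
  also have "\<dots> = trace (matrix G)"
    by (simp add: f trace_matrix)
  finally show ?thesis .
qed

end

text \<open>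
  The symmetries of a curvature tensor at one point.  Additivity in the last argument is the only
  linearity that is assumed: it suffices to polarize \<open>g(R(u,v)w, w) = 0\<close>, and the skew symmetry
  thereby obtained yields full linearity in that argument from that of \<open>g\<close>.
\<close>

locale algebraic_curvature = scalar_product g
  for g :: "real ^ 'n::finite \<Rightarrow> real ^ 'n \<Rightarrow> real" +
  fixes R :: "real ^ 'n \<Rightarrow> real ^ 'n \<Rightarrow> real ^ 'n \<Rightarrow> real ^ 'n"
    and n :: real
  assumes dimension: "n = real CARD('n)"
    and skew: "R u v w = - R v u w"
    and additive: "R u v (w + w') = R u v w + R u v w'"
    and bianchi: "R u v w + R v w u + R w u v = 0"
    and orthogonal: "g (R u v w) w = 0"
begin

abbreviation "S \<equiv> ricci R"
abbreviation "Q \<equiv> ricci_op g R"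
abbreviation "r \<equiv> scalar_curvature g R"

lemma skew_last: "g (R u v w) z = - g (R u v z) w"
  using orthogonal[of u v "w + z"] orthogonal[of u v w] orthogonal[of u v z]
  by (simp add: additive linear_simps)

lemma skew_first: "g (R u v w) z = - g (R v u w) z"
  by (subst skew) (simp add: linear_simps)

lemma bianchi_scalar: "g (R u v w) z + g (R v w u) z + g (R w u v) z = 0"
  using arg_cong[OF bianchi[of u v w], of "\<lambda>x. g x z"] bilinear_lzero[OF bilinear]
  by (simp add: linear_simps)

text \<open>
  The four Bianchi identities on \<open>u, v, w, z\<close> (Milnor's octahedron) determine this once all terms
  are reduced to six representatives by the skew symmetries.
\<close>

lemma pair_symmetry: "g (R u v w) z = g (R w z u) v"
proof -
  show ?thesis
    using bianchi_scalar[of u v w z] bianchi_scalar[of v w z u] bianchi_scalar[of w z u v]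
      bianchi_scalar[of z u v w]
      skew_last[of v w z u] skew_last[of w z v u] skew_first[of z v w u] skew_last[of v z w u]
      skew_first[of z u w v] skew_last[of u z w v] skew_first[of u w z v] skew_last[of w u z v]
      skew_first[of z u v w] skew_last[of u v z w]
    by linarith
qed

lemma linear_R: "linear (R u v)"
proof (rule linearI_scalar_product)
  fix z
  have "(\<lambda>w. g (R u v w) z) = (\<lambda>w. - g (R u v z) w)"
    by (rule ext) (rule skew_last)
  then show "linear (\<lambda>w. g (R u v w) z)"
    by (simp add: linear_compose_neg linear_right)
qed

lemma ricci_sum: "S y z = (\<Sum>i\<in>UNIV. R (axis i 1) y z $ i)"
  by (simp add: ricci_def trace_matrix)

text \<open>
  By the pair symmetry, the adjoint of \<open>x \<mapsto> R(x, y)z\<close> is \<open>w \<mapsto> R(w, z)y\<close>, and adjoint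
  endomorphisms have the same trace.
\<close>

lemma ricci_commute: "S y z = S z y"
  unfolding ricci_def
proof (rule trace_adjoint)
  show "g (R x y z) w = g x (R w z y)" for x w
    using pair_symmetry[of x y z w] skew_first[of z w x y] skew_last[of w z x y]
      commute[of x "R w z y"] by simp
qed

lemma ricci_linear_right: "linear (S y)"
  by (rule linearI)
     (simp_all add: ricci_sum linear_add[OF linear_R] linear_scale[OF linear_R]
        sum.distrib sum_distrib_left)

lemma ricci_linear_left: "linear (\<lambda>y. S y z)"
  using ricci_linear_right[of z] by (simp add: ricci_commute[of _ z])

lemma ricci_op: "g (Q x) y = S x y"
proof -
  obtain w where w: "\<And>y. g w y = S x y"
    using functional_representable[OF ricci_linear_right[of x]] by blast
  then have "Q x = w"
    unfolding ricci_op_def by (intro the_equality) (auto intro: eqI)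
  then show ?thesis by (simp add: w)
qed

lemma ricci_op_self_adjoint: "g (Q x) y = g x (Q y)"
  by (metis ricci_op ricci_commute commute)

text \<open>
  Contraction term by term.  The endomorphisms \<open>x \<mapsto> \<phi>(x) w\<close> of rank one have trace \<open>\<phi> w\<close>;
  the symmetry of the Ricci tensor identifies the contractions with coefficients
  \<open>b\<^sub>2, b\<^sub>3, b\<^sub>5, b\<^sub>6\<close>.
\<close>

lemma ricci_T_curv:
  "ricci (T_curv b g R) y z =
     (b 0 + n * b 1 + b 2 + b 3 + b 5 + b 6) * S y z
     + (b 4 + (n - 1) * b 7) * r * g y z"
proof -
  have contract: "(\<Sum>i\<in>UNIV. \<phi> (axis i 1) * w $ i) = \<phi> w" if "linear \<phi>"
    for \<phi> :: "real ^ 'n \<Rightarrow> real" and w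
    using linear_axis_expansion[OF that, of w] by (simp add: mult.commute)
  have tr_Q: "(\<Sum>i\<in>UNIV. Q (axis i 1) $ i) = r"
    by (simp add: scalar_curvature_def trace_matrix)
  have id: "(\<Sum>i\<in>UNIV. c * (axis i 1 :: real ^ 'n) $ i) = n * c" for c :: real
    by (simp add: axis_def dimension)
  have "ricci (T_curv b g R) y z =
      b 0 * (\<Sum>i\<in>UNIV. R (axis i 1) y z $ i)
    + (\<Sum>i\<in>UNIV. (b 1 * S y z) * (axis i 1 :: real ^ 'n) $ i)
    + b 2 * (\<Sum>i\<in>UNIV. S (axis i 1) z * y $ i)
    + b 3 * (\<Sum>i\<in>UNIV. S (axis i 1) y * z $ i)
    + b 4 * g y z * (\<Sum>i\<in>UNIV. Q (axis i 1) $ i)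
    + b 5 * (\<Sum>i\<in>UNIV. g (axis i 1) z * Q y $ i)
    + b 6 * (\<Sum>i\<in>UNIV. g (axis i 1) y * Q z $ i)
    + b 7 * r * ((\<Sum>i\<in>UNIV. g y z * (axis i 1 :: real ^ 'n) $ i) - (\<Sum>i\<in>UNIV. g (axis i 1) z * y $ i))"
    unfolding ricci_def[of "T_curv b g R"] trace_matrix T_curv_def
    by (simp only: vector_add_component vector_minus_component vector_scaleR_component
        real_scaleR_def sum.distrib sum_subtractf sum_distrib_left right_diff_distrib mult.assoc)
  also have "\<dots> = b 0 * S y z + n * (b 1 * S y z) + b 2 * S y z + b 3 * S z y + b 4 * g y z * r
    + b 5 * g (Q y) z + b 6 * g (Q z) y + b 7 * r * (n * g y z - g y z)"
    by (simp only: contract[OF ricci_linear_left] contract[OF linear_left] tr_Q id ricci_sum[symmetric])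
  finally show ?thesis
    by (simp add: ricci_op ricci_commute[of z y] algebra_simps)
qed

end

locale nullity_vector = algebraic_curvature g R n
  for g :: "real ^ 'n::finite \<Rightarrow> real ^ 'n \<Rightarrow> real" and R n +
  fixes k \<epsilon> :: real and \<xi> :: "real ^ 'n"
  assumes sign: "\<epsilon> \<in> {1, - 1}" and unit: "g \<xi> \<xi> = \<epsilon>" and nullity: "\<xi> \<in> nullity k g R"
begin

text \<open>
  The eigenvalue of the Ricci operator at \<open>\<xi>\<close>.
\<close>

abbreviation "\<kappa> \<equiv> k * (n - 1)"

lemma R_xi_right: "R x y \<xi> = k *\<^sub>R (g y \<xi> *\<^sub>R x - g x \<xi> *\<^sub>R y)"
  using nullity by (simp add: nullity_def)

text \<open>
  The nullity condition prescribes \<open>R\<close> with \<open>\<xi>\<close> in the last argument; the pair symmetry moves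
  \<open>\<xi>\<close> to the first.
\<close>

lemma R_xi_left: "R \<xi> y u = k *\<^sub>R (g y u *\<^sub>R \<xi> - g \<xi> u *\<^sub>R y)"
proof (rule eqI)
  show "g (R \<xi> y u) z = g (k *\<^sub>R (g y u *\<^sub>R \<xi> - g \<xi> u *\<^sub>R y)) z" for z
    by (simp add: pair_symmetry[of \<xi> y u z] R_xi_right linear_simps commute[of u] commute[of z]
        algebra_simps)
qed

lemma ricci_xi: "S y \<xi> = \<kappa> * g y \<xi>"
proof -
  have "S y \<xi> = k * ((\<Sum>i\<in>UNIV. g y \<xi> * (axis i 1 :: real ^ 'n) $ i)
      - (\<Sum>i\<in>UNIV. (y $ i) *\<^sub>R g (axis i 1) \<xi>))"
    by (simp add: ricci_sum R_xi_right sum_distrib_left sum_subtractf right_diff_distrib mult.commute)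
  also have "\<dots> = k * (n * g y \<xi> - g y \<xi>)"
    by (simp only: linear_axis_expansion[OF linear_left]) (simp add: axis_def dimension)
  finally show ?thesis by (simp add: algebra_simps)
qed

lemma ricci_op_xi: "Q \<xi> = \<kappa> *\<^sub>R \<xi>"
  by (rule eqI) (simp add: ricci_op ricci_commute[of \<xi>] ricci_xi linear_simps commute[of \<xi>])

lemma ricci_power_xi: "ricci_power g R l y \<xi> = \<kappa> ^ l * g y \<xi>"
proof (induction l)
  case 0
  then show ?case by (simp add: ricci_power_def)
next
  case (Suc l)
  then show ?case
    by (simp add: ricci_power_def ricci_op ricci_xi)
qed

lemma ricci_power_xi_left: "ricci_power g R l \<xi> y = \<kappa> ^ l * g \<xi> y"
proof -
  have "(Q ^^ l) \<xi> = \<kappa> ^ l *\<^sub>R \<xi>"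
  proof (induction l)
    case (Suc l)
    have "linear Q"
      by (rule linearI_scalar_product) (simp add: ricci_op ricci_linear_left)
    then show ?case by (simp add: Suc ricci_op_xi linear_scale mult.commute)
  qed simp
  then show ?thesis by (simp add: ricci_power_def linear_simps)
qed

text \<open>
  Two of the four arguments of the pseudosymmetry equation are set to \<open>\<xi>\<close>.  With
  \<open>S\<^sub>b = B S + C g\<close> and \<open>Q \<xi> = \<kappa> \<xi>\<close>, contraction of \<open>S\<^sub>b\<close> with \<open>\<xi>\<close> is \<open>B \<kappa> + C\<close> times that of
  \<open>g\<close>, so only the vectors \<open>T\<^sub>a(\<xi>, Y)\<xi>\<close> and the \<open>\<xi>\<close>-component of \<open>T\<^sub>a(\<xi>, Y)U\<close> enter, and both
  are determined by the nullity condition and \<open>Q\<close>.  The term in \<open>S\<^sup>2\<close> arises from \<open>B S(U, Q Y)\<close>.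
\<close>

lemma pseudosymmetry_at_xi:
  assumes eq: "curv_act (T_curv a g R) (ricci (T_curv b g R)) U \<xi> \<xi> Y =
    L * tachibana (ricci_power g R l) (ricci (T_curv b g R)) U \<xi> \<xi> Y"
  shows "\<epsilon> * a 5 * (b 0 + n * b 1 + b 2 + b 3 + b 5 + b 6) * ricci_power g R 2 Y U
    + (\<epsilon> * (b 0 + n * b 1 + b 2 + b 3 + b 5 + b 6)
         * (- k * a 0 + k * (n - 1) * a 1 + k * (n - 1) * a 2 - a 7 * r)
       + \<epsilon> * (a 1 + a 5) * (b 4 * r + (n - 1) * b 7 * r)) * S Y U
    + (\<epsilon> * k * (n - 1) * (a 2 + a 4) * (b 4 * r + (n - 1) * b 7 * r)
       + \<epsilon> * k * (n - 1) * (b 0 + n * b 1 + b 2 + b 3 + b 5 + b 6)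
         * (k * a 0 + k * (n - 1) * a 4 + a 7 * r)) * g Y U
    + k * (n - 1) * (a 1 + a 2 + 2 * a 3 + a 4 + a 5 + 2 * a 6)
       * (b 4 * r + (n - 1) * b 7 * r
          + k * (n - 1) * (b 0 + n * b 1 + b 2 + b 3 + b 5 + b 6)) * (\<epsilon> * g Y \<xi>) * (\<epsilon> * g U \<xi>)
    = L * \<epsilon> *
      ((b 0 + n * b 1 + b 2 + b 3 + b 5 + b 6)
         * (k * (n - 1) * ricci_power g R l Y U - k ^ l * (n - 1) ^ l * S Y U)
       + (b 4 + (n - 1) * b 7) * r
         * (ricci_power g R l Y U - k ^ l * (n - 1) ^ l * g Y U))"
proof -
  define B where "B = b 0 + n * b 1 + b 2 + b 3 + b 5 + b 6"
  define C where "C = (b 4 + (n - 1) * b 7) * r"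
  define K where "K = \<kappa>"
  define P where "P = \<kappa> ^ l"
  define S\<^sub>b where "S\<^sub>b = ricci (T_curv b g R)"
  have S\<^sub>b: "S\<^sub>b v w = B * g (Q v) w + C * g v w" for v w
    by (simp add: S\<^sub>b_def ricci_T_curv B_def C_def ricci_op)
  have S\<^sub>b': "S\<^sub>b v w = B * g v (Q w) + C * g v w" for v w
    by (simp add: S\<^sub>b ricci_op_self_adjoint)
  have S\<^sub>b_xi: "S\<^sub>b v \<xi> = (B * \<kappa> + C) * g v \<xi>" for v
    by (simp add: S\<^sub>b' ricci_op_xi linear_simps algebra_simps)
  have S\<^sub>b_right: "S\<^sub>b v (w + w') = S\<^sub>b v w + S\<^sub>b v w'" "S\<^sub>b v (w - w') = S\<^sub>b v w - S\<^sub>b v w'"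
      "S\<^sub>b v (c *\<^sub>R w) = c * S\<^sub>b v w" for v w w' c
    by (simp_all add: S\<^sub>b linear_simps algebra_simps)
  have xi_y: "g \<xi> Y = g Y \<xi>" "g \<xi> U = g U \<xi>" by (rule commute)+
  have T1: "g (T_curv a g R \<xi> Y U) \<xi> =
      a 0 * k * (g Y U * \<epsilon> - g U \<xi> * g Y \<xi>) + a 1 * S Y U * \<epsilon> + a 2 * \<kappa> * g U \<xi> * g Y \<xi>
      + a 3 * \<kappa> * g Y \<xi> * g U \<xi> + a 4 * g Y U * \<kappa> * \<epsilon> + a 5 * g U \<xi> * \<kappa> * g Y \<xi>
      + a 6 * g Y \<xi> * \<kappa> * g U \<xi> + a 7 * r * (g Y U * \<epsilon> - g U \<xi> * g Y \<xi>)"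
    unfolding T_curv_def
    by (simp add: linear_simps R_xi_left unit ricci_op ricci_xi ricci_commute[of \<xi>] xi_y algebra_simps)
  have T2: "T_curv a g R \<xi> Y \<xi> =
      (a 0 * k) *\<^sub>R (g Y \<xi> *\<^sub>R \<xi> - \<epsilon> *\<^sub>R Y) + (a 1 * \<kappa> * g Y \<xi>) *\<^sub>R \<xi> + (a 2 * \<kappa> * \<epsilon>) *\<^sub>R Y
      + (a 3 * \<kappa> * g Y \<xi>) *\<^sub>R \<xi> + (a 4 * g Y \<xi> * \<kappa>) *\<^sub>R \<xi> + (a 5 * \<epsilon>) *\<^sub>R Q Y
      + (a 6 * g Y \<xi> * \<kappa>) *\<^sub>R \<xi> + (a 7 * r) *\<^sub>R (g Y \<xi> *\<^sub>R \<xi> - \<epsilon> *\<^sub>R Y)"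
    unfolding T_curv_def
    by (simp add: R_xi_left unit ricci_op_xi ricci_xi ricci_commute[of \<xi> Y] xi_y mult.assoc)
  have S\<^sub>b_u: "S\<^sub>b U Y = B * S Y U + C * g Y U"
      "S\<^sub>b U (Q Y) = B * ricci_power g R 2 Y U + C * S Y U"
    by (simp_all add: S\<^sub>b' commute[of U] ricci_op ricci_power_def numeral_2_eq_2)
  have left: "curv_act (T_curv a g R) S\<^sub>b U \<xi> \<xi> Y =
      - ((B * \<kappa> + C) * g (T_curv a g R \<xi> Y U) \<xi>) - S\<^sub>b U (T_curv a g R \<xi> Y \<xi>)"
    by (simp add: curv_act_def endo_act_def S\<^sub>b_xi)
  have right: "tachibana (ricci_power g R l) S\<^sub>b U \<xi> \<xi> Y =
      - ((B * \<kappa> + C) * (ricci_power g R l Y U * \<epsilon> - \<kappa> ^ l * g U \<xi> * g Y \<xi>))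
      - (\<kappa> ^ l * g Y \<xi> * ((B * \<kappa> + C) * g U \<xi>) - \<kappa> ^ l * \<epsilon> * (B * S Y U + C * g Y U))"
    by (simp add: tachibana_def endo_act_def wedge_def S\<^sub>b_right S\<^sub>b_xi S\<^sub>b_u linear_simps unit
        ricci_power_xi ricci_power_xi_left xi_y)
  have C': "b 4 * r + (n - 1) * b 7 * r = C" by (simp add: C_def algebra_simps)
  have P': "k ^ l * (n - 1) ^ l = P" by (simp add: P_def power_mult_distrib)
  have sign': "\<epsilon> * \<epsilon> = 1" using sign by auto
  have "\<epsilon> * a 5 * B * ricci_power g R 2 Y U
      + (\<epsilon> * B * (- k * a 0 + K * a 1 + K * a 2 - a 7 * r) + \<epsilon> * (a 1 + a 5) * C) * S Y U
      + (\<epsilon> * K * (a 2 + a 4) * C + \<epsilon> * K * B * (k * a 0 + K * a 4 + a 7 * r)) * g Y U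
      + K * (a 1 + a 2 + 2 * a 3 + a 4 + a 5 + 2 * a 6) * (C + K * B) * g Y \<xi> * g U \<xi>
    = L * \<epsilon> * (B * (K * ricci_power g R l Y U - P * S Y U)
      + C * (ricci_power g R l Y U - P * g Y U))"
    using eq unfolding S\<^sub>b_def[symmetric] left right T1 T2
    unfolding S\<^sub>b_right S\<^sub>b_xi S\<^sub>b_u P_def[symmetric]
    unfolding K_def[symmetric]
    by algebra
  then show ?thesis
    using sign' unfolding B_def[symmetric] C' C_def[symmetric] P' K_def
    by algebra
qed

end

section \<open>The identity on the manifold\<close>

context levi_civita_curvature
begin

lemma algebraic_curvature: "algebraic_curvature (g p) (R p) (real CARD('n))"
proof
  show "bilinear (g p)" by (rule bilinear_g)
  show "g p u v = g p v u" for u v by (rule g_commute)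
  show "u = 0" if "\<And>v. g p u v = 0" for u using that by (rule g_nondegenerate)
  show "real CARD('n) = real CARD('n)" by (rule refl)
  show "R p u v w = - R p v u w" for u v w by (rule curvature_skew)
  show "R p u v (w + w') = R p u v w + R p u v w'" for u v w w' by (rule curvature_add)
  show "R p u v w + R p v w u + R p w u v = 0" for u v w by (rule curvature_bianchi)
  show "g p (R p u v w) w = 0" for u v w by (rule curvature_orthogonal)
qed

end

lemma N_k_xi_manifold_nullity_vector:
  fixes A :: "('a::{t2_space, second_countable_topology}, 'n::finite) chart set"
  assumes N: "N_k_xi_manifold A g D R k \<epsilon> \<xi>"
  shows "nullity_vector (g p) (R p) (real CARD('n)) k \<epsilon> (\<xi> p)"
proof -
  have "levi_civita_curvature A g D R"
    using N by (simp add: N_k_xi_manifold_def levi_civita_curvature_def)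
  then interpret algebraic_curvature "g p" "R p" "real CARD('n)"
    by (rule levi_civita_curvature.algebraic_curvature)
  show ?thesis
    by unfold_locales (use N in \<open>auto simp: N_k_xi_manifold_def\<close>)
qed

theorem theorem7p2:
  fixes A :: "('a::{t2_space, second_countable_topology}, 'n::finite) chart set"
    and g :: "'a \<Rightarrow> real ^ 'n \<Rightarrow> real ^ 'n \<Rightarrow> real"
    and D :: "('a \<Rightarrow> real ^ 'n) \<Rightarrow> 'a \<Rightarrow> real ^ 'n \<Rightarrow> real ^ 'n"
    and R :: "'a \<Rightarrow> real ^ 'n \<Rightarrow> real ^ 'n \<Rightarrow> real ^ 'n \<Rightarrow> real ^ 'n"
    and k \<epsilon> :: real
    and \<xi> :: "'a \<Rightarrow> real ^ 'n"
    and a b :: "nat \<Rightarrow> real"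
    and l :: nat
    and n :: real
    and S :: "'a \<Rightarrow> real ^ 'n \<Rightarrow> real ^ 'n \<Rightarrow> real"
    and Spow :: "nat \<Rightarrow> 'a \<Rightarrow> real ^ 'n \<Rightarrow> real ^ 'n \<Rightarrow> real"
    and r :: "'a \<Rightarrow> real"
    and \<eta> :: "'a \<Rightarrow> real ^ 'n \<Rightarrow> real"
  assumes "N_k_xi_manifold A g D R k \<epsilon> \<xi>"
  defines "n \<equiv> real CARD('n)"
    and "S \<equiv> \<lambda>p. ricci (R p)"
    and "Spow \<equiv> \<lambda>m p. ricci_power (g p) (R p) m"
    and "r \<equiv> \<lambda>p. scalar_curvature (g p) (R p)"
    and "\<eta> \<equiv> \<lambda>p x. \<epsilon> * g p x (\<xi> p)"
  shows
    "(\<forall>L. pseudosymmetric A g R a b l L \<longrightarrow>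
       (\<forall>p Y U.
          \<epsilon> * a 5 * (b 0 + n * b 1 + b 2 + b 3 + b 5 + b 6) * Spow 2 p Y U
        + (\<epsilon> * (b 0 + n * b 1 + b 2 + b 3 + b 5 + b 6)
             * (- k * a 0 + k * (n - 1) * a 1 + k * (n - 1) * a 2 - a 7 * r p)
           + \<epsilon> * (a 1 + a 5) * (b 4 * r p + (n - 1) * b 7 * r p)) * S p Y U
        + (\<epsilon> * k * (n - 1) * (a 2 + a 4) * (b 4 * r p + (n - 1) * b 7 * r p)
           + \<epsilon> * k * (n - 1) * (b 0 + n * b 1 + b 2 + b 3 + b 5 + b 6)
             * (k * a 0 + k * (n - 1) * a 4 + a 7 * r p)) * g p Y U
        + k * (n - 1) * (a 1 + a 2 + 2 * a 3 + a 4 + a 5 + 2 * a 6)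
           * (b 4 * r p + (n - 1) * b 7 * r p
              + k * (n - 1) * (b 0 + n * b 1 + b 2 + b 3 + b 5 + b 6)) * \<eta> p Y * \<eta> p U
        = L p * \<epsilon> *
          ((b 0 + n * b 1 + b 2 + b 3 + b 5 + b 6)
             * (k * (n - 1) * Spow l p Y U - k ^ l * (n - 1) ^ l * S p Y U)
           + (b 4 + (n - 1) * b 7) * r p
             * (Spow l p Y U - k ^ l * (n - 1) ^ l * g p Y U))))
   \<and>
     (\<forall>L. pseudosymmetric A g R a a l L \<longrightarrow>
       (\<forall>p Y U.
          \<epsilon> * a 5 * (a 0 + n * a 1 + a 2 + a 3 + a 5 + a 6) * Spow 2 p Y U
        + (\<epsilon> * (a 0 + n * a 1 + a 2 + a 3 + a 5 + a 6)
             * (- k * a 0 + k * (n - 1) * a 1 + k * (n - 1) * a 2 - a 7 * r p)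
           + \<epsilon> * (a 1 + a 5) * (a 4 * r p + (n - 1) * a 7 * r p)) * S p Y U
        + (\<epsilon> * k * (n - 1) * (a 2 + a 4) * (a 4 * r p + (n - 1) * a 7 * r p)
           + \<epsilon> * k * (n - 1) * (a 0 + n * a 1 + a 2 + a 3 + a 5 + a 6)
             * (k * a 0 + k * (n - 1) * a 4 + a 7 * r p)) * g p Y U
        + k * (n - 1) * (a 1 + a 2 + 2 * a 3 + a 4 + a 5 + 2 * a 6)
           * (a 4 * r p + (n - 1) * a 7 * r p
              + k * (n - 1) * (a 0 + n * a 1 + a 2 + a 3 + a 5 + a 6)) * \<eta> p Y * \<eta> p U
        = L p * \<epsilon> *
          ((a 0 + n * a 1 + a 2 + a 3 + a 5 + a 6)
             * (k * (n - 1) * Spow l p Y U - k ^ l * (n - 1) ^ l * S p Y U)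
           + (a 4 + (n - 1) * a 7) * r p
             * (Spow l p Y U - k ^ l * (n - 1) ^ l * g p Y U))))"
proof -
  have at_xi: "curv_act (T_curv a (g p) (R p)) (ricci (T_curv c (g p) (R p))) U (\<xi> p) (\<xi> p) Y =
      L p * tachibana (ricci_power (g p) (R p) l) (ricci (T_curv c (g p) (R p))) U (\<xi> p) (\<xi> p) Y"
    if "pseudosymmetric A g R a c l L" for c L p U Y
    using that by (simp add: pseudosymmetric_def)
  note identity = nullity_vector.pseudosymmetry_at_xi[OF
      N_k_xi_manifold_nullity_vector[OF \<open>N_k_xi_manifold A g D R k \<epsilon> \<xi>\<close>] at_xi]
  show ?thesis
    unfolding n_def S_def Spow_def r_def \<eta>_def
    by (intro conjI allI impI) (erule identity)+
qed

end
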